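(* Let $H,\Xi,K$ be real separable Hilbert spaces, let $A$ be the generator of a strongly continuous semigroup $(e^{tA})_{t\ge 0}$ in $H$, let $G:\Xi\to H$ be bounded linear, let $P:H\to H$ be a bounded linear operator, and let $C:D(C)\subseteq K\to H$ be a linear (possibly unbounded) operator with dense domain. Let $\bar\phi:\operatorname{Im}(P)\to\mathbb R$ be measurable and bounded and define $\phi:H\to\mathbb R$ by $\phi(x)=\bar\phi(Px)$. Fix $t>0$ and assume that $Pe^{tA}C:K\to H$ is well defined. Then $R_t[\phi]$ is $C$-Fréchet differentiable if $$\operatorname{Im}\left(Pe^{tA}C\right)\subseteq \operatorname{Im}Q_t^{1/2}.$$ In this case, for every $x\in H$ and $k\in K$, $$\langle\nabla^C(R_t[\phi])(x),k\rangle_K=\int_H\bar\phi\left(Pz+Pe^{tA}x\right)\left\langle Q_t^{-1/2}Pe^{tA}Ck,\;Q_t^{-1/2}z\right\rangle_H\mathcal N(0,Q_t)(dz).$$ Moreover, for every $x\in H$ and $k\in K$, $$\left|\langle\nabla^C(R_t[\phi])(x),k\rangle_K\right|\le\|\bar\phi\|_\infty\,\left\|Q_t^{-1/2}Pe^{tA}C\right\|_{\mathcal L(K;H)}\,|k|_K.$$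
   Context: $Q_t=\int_0^te^{sA}GG^*e^{sA^*}ds$. It is assumed that $Q_t$ is trace class, so that the Ornstein-Uhlenbeck process $X^x(t)=e^{tA}x+\int_0^te^{(t-s)A}G\,dW_s$ ($W$ a cylindrical Wiener process in $\Xi$) is an $H$-valued Gaussian process with law $\mathcal N(e^{tA}x,Q_t)$ (mean $e^{tA}x$, covariance $Q_t$) at time $t$. The Ornstein-Uhlenbeck transition semigroup is $R_t[f](x)=\mathbb E f(X^x(t))=\int_Hf(z+e^{tA}x)\,\mathcal N(0,Q_t)(dz)$ for $f:H\to\mathbb R$ bounded Borel measurable. $Q_t^{-1/2}$ denotes the pseudoinverse of $Q_t^{1/2}$: for $y\in\operatorname{Im}Q_t^{1/2}$, $Q_t^{-1/2}y$ is the element of minimal norm among the $h$ with $Q_t^{1/2}h=y$. For $h\in H$, $z\mapsto\langle h,Q_t^{-1/2}z\rangle_H$ is the usual Gaussian random variable in $L^2(H,\mathcal N(0,Q_t))$ (white noise mapping). That $Pe^{tA}C:K\to H$ is well defined means that $Pe^{tA}C$ makes sense as an operator on all of $K$. $C$-derivatives: for $f:H\to\mathbb R$, the $C$-directional derivative at $x\in H$ in direction $k\in D(C)$ is $\nabla^Cf(x;k)=\lim_{s\to0}\frac{f(x+sCk)-f(x)}{s}$, if the limit exists. $f$ is $C$-Gâteaux differentiable at $x$ if this exists for every $k\in D(C)$ and there is a bounded linear functional $\nabla^Cf(x)\in K^*$ with $\nabla^Cf(x;k)=\nabla^Cf(x)k$ for $k\in D(C)$; it is $C$-Fréchet differentiable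 at $x$ if moreover the limit is uniform for $k$ in the unit ball of $K$ intersected with $D(C)$; it is $C$-Fréchet differentiable if this holds at every $x\in H$. $K^*$ is identified with $K$.
   Formalization: Added assumption: P acts as the identity on Im(Pe^{tA}C), as any projection does; for general bounded P the gradient formula fails (P=2I, A=0, G=C=I on ℝ gives twice the derivative). "Well defined" is read as Pe^{tA}C having a bounded linear extension to K. *)

theory Defs
  imports "HOL-Probability.Probability"
begin

text \<open>
  Real separable Hilbert spaces are types of sort
  \<open>{real_inner, banach, second_countable_topology}\<close>.
\<close>

definition C0_semigroup :: "(real \<Rightarrow> 'h \<Rightarrow> 'h::{real_inner, banach}) \<Rightarrow> bool" where
  "C0_semigroup S \<longleftrightarrow>
     (\<forall>t\<ge>0. bounded_linear (S t)) \<and>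
     S 0 = id \<and>
     (\<forall>s\<ge>0. \<forall>t\<ge>0. S (s + t) = S s \<circ> S t) \<and>
     (\<forall>x. ((\<lambda>t. S t x) \<longlongrightarrow> x) (at_right 0))"

text \<open>The operator \<open>A\<close> with domain \<open>D\<close> is the generator of \<open>S\<close>, so that \<open>S t\<close> is
  $e^{tA}$. Values of \<open>A\<close> outside \<open>D\<close> are irrelevant.\<close>

definition generator :: "'h set \<Rightarrow> ('h \<Rightarrow> 'h) \<Rightarrow> (real \<Rightarrow> 'h \<Rightarrow> 'h::{real_inner, banach}) \<Rightarrow> bool" where
  "generator D A S \<longleftrightarrow>
     D = {x. \<exists>y. ((\<lambda>r. (S r x - x) /\<^sub>R r) \<longlongrightarrow> y) (at_right 0)} \<and>
     (\<forall>x\<in>D. ((\<lambda>r. (S r x - x) /\<^sub>R r) \<longlongrightarrow> A x) (at_right 0))"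

definition densely_defined_operator ::
    "'k set \<Rightarrow> ('k::real_inner \<Rightarrow> 'h::real_inner) \<Rightarrow> bool" where
  "densely_defined_operator D C \<longleftrightarrow>
     subspace D \<and> closure D = UNIV \<and>
     (\<forall>x\<in>D. \<forall>y\<in>D. C (x + y) = C x + C y) \<and>
     (\<forall>r. \<forall>x\<in>D. C (r *\<^sub>R x) = r *\<^sub>R C x)"

definition op_sqrt :: "('h \<Rightarrow> 'h) \<Rightarrow> 'h \<Rightarrow> 'h::{real_inner, banach}" where
  "op_sqrt T = (THE R. bounded_linear R \<and> (\<forall>x y. R x \<bullet> y = x \<bullet> R y) \<and>
                       (\<forall>x. 0 \<le> R x \<bullet> x) \<and> R \<circ> R = T)"

text \<open>Pseudoinverse; meaningful at the points of \<open>range R\<close>.\<close>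

definition pseudoinverse :: "('h \<Rightarrow> 'h) \<Rightarrow> 'h \<Rightarrow> 'h::{real_inner, banach}" where
  "pseudoinverse R y = (ARG_MIN norm h. R h = y)"

definition hilbert_basis :: "'h::{real_inner, banach} set \<Rightarrow> bool" where
  "hilbert_basis E \<longleftrightarrow>
     pairwise orthogonal E \<and> (\<forall>e\<in>E. norm e = 1) \<and> closure (span E) = UNIV"

text \<open>$\mathrm{tr}\,|T| < \infty$ with $|T| = (T^*T)^{1/2}$. The sum does not depend on the
  basis, so that \<open>some\<close> and \<open>every\<close> basis give the same notion.\<close>

definition trace_class :: "('h \<Rightarrow> 'h::{real_inner, banach}) \<Rightarrow> bool" where
  "trace_class T \<longleftrightarrow> bounded_linear T \<and>
     (\<exists>E. hilbert_basis E \<and> (\<lambda>e. op_sqrt (adjoint T \<circ> T) e \<bullet> e) summable_on E)"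

text \<open>$Q_t = \int_0^t e^{sA} G G^* e^{sA^*}\,ds$ as a strong (pointwise Bochner) integral.\<close>

definition Q_op :: "(real \<Rightarrow> 'h \<Rightarrow> 'h) \<Rightarrow> ('x::{real_inner, banach} \<Rightarrow> 'h) \<Rightarrow> real \<Rightarrow>
    'h \<Rightarrow> 'h::{real_inner, banach, second_countable_topology}" where
  "Q_op S G t x = (LINT s:{0..t}|lborel. S s (G (adjoint G (adjoint (S s) x))))"

definition normal_law :: "real \<Rightarrow> real \<Rightarrow> real measure" where
  "normal_law m v =
     (if v = 0 then return borel m
      else density lborel (\<lambda>x. ennreal (normal_density m (sqrt v) x)))"

text \<open>\<open>\<mu>\<close> is $\mathcal N(m, Q)$: every functional \<open>\<lambda>z. h \<bullet> z\<close> is normally distributed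
  with mean \<open>h \<bullet> m\<close> and variance \<open>h \<bullet> Q h\<close>. For symmetric \<open>Q\<close>, the variances determine
  the covariances by polarization.\<close>

definition gaussian_measure ::
    "'h \<Rightarrow> ('h \<Rightarrow> 'h) \<Rightarrow> 'h::{real_inner, banach, second_countable_topology} measure \<Rightarrow> bool" where
  "gaussian_measure m Q \<mu> \<longleftrightarrow>
     prob_space \<mu> \<and> sets \<mu> = sets borel \<and>
     (\<forall>h. distr \<mu> borel (\<lambda>z. h \<bullet> z) = normal_law (h \<bullet> m) (h \<bullet> Q h))"

text \<open>Here \<open>\<mu>\<close> is to be $\mathcal N(0, Q_t)$, so that \<open>z + S t x\<close> has the law
  $\mathcal N(e^{tA}x, Q_t)$ of the Ornstein-Uhlenbeck process started at \<open>x\<close>.\<close>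

definition OU_semigroup :: "(real \<Rightarrow> 'h \<Rightarrow> 'h) \<Rightarrow>
    'h::{real_inner, banach, second_countable_topology} measure \<Rightarrow> real \<Rightarrow> ('h \<Rightarrow> real) \<Rightarrow> 'h \<Rightarrow> real" where
  "OU_semigroup S \<mu> t f x = (LINT z|\<mu>. f (z + S t x))"

text \<open>
  White noise mapping $z \mapsto \langle h, Q^{-1/2} z\rangle$. For $h \in \mathrm{Im}\,Q^{1/2}$
  it is $z \mapsto \langle Q^{-1/2} h, z\rangle$. The map \<open>h \<mapsto> white_noise Q \<mu> h\<close> is isometric from
  $\mathrm{Im}\,Q^{1/2}$ into $L^2(\mu)$; it extends by continuity to the closure of
  $\mathrm{Im}\,Q^{1/2}$, and to the whole space by orthogonal projection (\<open>h'\<close> below) onto that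
  closure. The resulting class in $L^2(\mu)$ is unique, and \<open>white_noise\<close> picks a representative.
\<close>

definition is_white_noise :: "('h \<Rightarrow> 'h) \<Rightarrow>
    'h::{real_inner, banach, second_countable_topology} measure \<Rightarrow> 'h \<Rightarrow> ('h \<Rightarrow> real) \<Rightarrow> bool" where
  "is_white_noise Q \<mu> h w \<longleftrightarrow>
     w \<in> borel_measurable \<mu> \<and>
     (\<exists>h' g. (\<forall>n. g n \<in> range (op_sqrt Q)) \<and> g \<longlonglongrightarrow> h' \<and>
        (\<forall>y\<in>range (op_sqrt Q). (h - h') \<bullet> y = 0) \<and>
        (\<lambda>n. \<integral>\<^sup>+ z. ennreal ((pseudoinverse (op_sqrt Q) (g n) \<bullet> z - w z)\<^sup>2) \<partial>\<mu>) \<longlonglongrightarrow> 0)"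

definition white_noise :: "('h \<Rightarrow> 'h) \<Rightarrow>
    'h::{real_inner, banach, second_countable_topology} measure \<Rightarrow> 'h \<Rightarrow> 'h \<Rightarrow> real" where
  "white_noise Q \<mu> h = (SOME w. is_white_noise Q \<mu> h w)"

definition has_C_dir_derivative ::
    "('k \<Rightarrow> 'h::real_inner) \<Rightarrow> ('h \<Rightarrow> real) \<Rightarrow> 'h \<Rightarrow> 'k::real_inner \<Rightarrow> real \<Rightarrow> bool" where
  "has_C_dir_derivative C f x k l \<longleftrightarrow>
     ((\<lambda>s. (f (x + s *\<^sub>R C k) - f x) / s) \<longlongrightarrow> l) (at 0)"

definition has_C_gateaux_derivative ::
    "'k set \<Rightarrow> ('k \<Rightarrow> 'h::real_inner) \<Rightarrow> ('h \<Rightarrow> real) \<Rightarrow> 'h \<Rightarrow> ('k::real_inner \<Rightarrow> real) \<Rightarrow> bool" where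
  "has_C_gateaux_derivative D C f x L \<longleftrightarrow>
     bounded_linear L \<and> (\<forall>k\<in>D. has_C_dir_derivative C f x k (L k))"

definition C_frechet_differentiable_at ::
    "'k set \<Rightarrow> ('k::real_inner \<Rightarrow> 'h::real_inner) \<Rightarrow> ('h \<Rightarrow> real) \<Rightarrow> 'h \<Rightarrow> bool" where
  "C_frechet_differentiable_at D C f x \<longleftrightarrow>
     (\<exists>L. has_C_gateaux_derivative D C f x L \<and>
          uniform_limit (cball 0 1 \<inter> D) (\<lambda>s k. (f (x + s *\<^sub>R C k) - f x) / s) L (at 0))"

definition C_frechet_differentiable ::
    "'k set \<Rightarrow> ('k::real_inner \<Rightarrow> 'h::real_inner) \<Rightarrow> ('h \<Rightarrow> real) \<Rightarrow> bool" where
  "C_frechet_differentiable D C f \<longleftrightarrow> (\<forall>x. C_frechet_differentiable_at D C f x)"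

text \<open>$\nabla^C f(x) \in K^*$ as an element of $K$; unique because \<open>D\<close> is dense.\<close>

definition C_gradient ::
    "'k set \<Rightarrow> ('k \<Rightarrow> 'h::real_inner) \<Rightarrow> ('h \<Rightarrow> real) \<Rightarrow> 'h \<Rightarrow> 'k::{real_inner, banach}" where
  "C_gradient D C f x = (THE g. has_C_gateaux_derivative D C f x (\<lambda>k. g \<bullet> k))"

text \<open>
  Two readings used in the theorem. That $P e^{tA} C : K \to H$ is well defined means that the
  densely defined operator $P e^{tA} C$ has a (unique) bounded linear extension to $K$.
  The bounded operator $P$ need not be a projection, but it has to act as the identity on
  $\mathrm{Im}(P e^{tA} C)$, as any projection does: otherwise shifting \<open>z\<close> by
  $P e^{tA} C k$ does not shift \<open>P z\<close> by $P e^{tA} C k$, and the gradient formula fails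
  (\<open>P = 2 I\<close>, \<open>A = 0\<close>, \<open>G = C = I\<close> on the real line yields twice the derivative).
\<close>

end

theory Submission
  imports Defs
begin

text \<open>
  Write \<open>f z = \<phi>bar (P z + P (S t x))\<close> and \<open>R = Q\<^sup>1\<^sup>/\<^sup>2\<close>. As \<open>P\<close> fixes \<open>P (S t (C k))\<close>, one has
  \<open>R\<phi> (x + s *\<^sub>R C k) = \<integral> f (z + s *\<^sub>R R y) d\<mu>\<close> with \<open>y = R\<^sup>-\<^sup>1 (P e\<^sup>t\<^sup>A C k)\<close>, and it suffices to show the
  second-order estimate
  \[ \Big|\int f(z + s R y)\,d\mu - \int f\,d\mu - s \int f\, w_y\,d\mu\Big|
     \leq s^2\, |y|^2\, \|f\|_\infty , \]
  where \<open>w\<^sub>y\<close> is the white noise of \<open>y\<close>. It is uniform in \<open>k\<close> on the unit ball because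
  \<open>R\<^sup>-\<^sup>1 P e\<^sup>t\<^sup>A C\<close> is bounded (closed graph theorem).

  No Cameron-Martin density is needed: for \<open>R y = Q v\<close> and a trigonometric polynomial \<open>f\<close>, Gaussian
  integration by parts gives the second derivative of \<open>s \<mapsto> \<integral> f (z + s *\<^sub>R Q v) d\<mu>\<close> as
  \<open>\<integral> f (z + s *\<^sub>R Q v) ((v \<bullet> z)\<^sup>2 - v \<bullet> Q v) d\<mu>\<close>, whose modulus is at most
  \<open>2 (v \<bullet> Q v)\<close> times the supremum norm of \<open>f\<close>. The estimate does not involve derivatives of \<open>f\<close>, so
  it passes to all \<open>y\<close> by density and to bounded Borel \<open>f\<close> by approximation with trigonometric
  polynomials (Stone-Weierstrass and inner regularity).
\<close>

section \<open>Orthogonality, duality and uniform boundedness\<close>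

text \<open>\<open>gaussian_measure\<close> only prescribes the laws of single functionals
  \<open>h \<bullet> z\<close>. A cosine depends on one such functional, which makes trigonometric
  polynomials the natural test functions: joint information about \<open>u \<bullet> z\<close> and
  \<open>v \<bullet> z\<close> is extracted by differentiating the characteristic function along
  \<open>u + r *\<^sub>R v\<close>. For \<open>y = R v\<close> the variance
  \<open>v \<bullet> Q v\<close> is \<open>(norm y)\<^sup>2\<close>. The estimate then no longer
  mentions \<open>v\<close>, so it survives limits in \<open>y\<close> along which the preimages
  \<open>v\<close> diverge. These limits reach every \<open>y\<close> that occurs: a preimage of
  least norm is orthogonal to the kernel of the symmetric \<open>R\<close>, hence lies in the
  closure of its range. Two further obstacles shape the proof. \<open>op_sqrt\<close>,
  \<open>adjoint\<close> and \<open>pseudoinverse\<close> are given by description or choice, so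
  existence has to be established before they mean anything. And \<open>white_noise\<close> picks a
  representative for each argument separately, so that linearity of the gradient in \<open>k\<close>
  becomes visible only after integration.\<close>

lemma closed_convex_min_norm:
  fixes V :: "'a::{real_inner, banach} set"
  assumes "closed V" "convex V" "V \<noteq> {}"
  obtains m where "m \<in> V" "\<And>x. x \<in> V \<Longrightarrow> norm m \<le> norm x"
proof -
  define d where "d = (INF x\<in>V. norm x)"
  have bdd: "bdd_below (norm ` V)" by (intro bdd_belowI[of _ 0]) auto
  have d_le: "d \<le> norm x" if "x \<in> V" for x
    unfolding d_def by (rule cINF_lower[OF bdd that])
  have d0: "0 \<le> d" unfolding d_def by (rule cINF_greatest[OF assms(3)]) auto
  have "\<exists>x. x \<in> V \<and> norm x < d + 1 / real (Suc n)" for n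
  proof -
    have "(INF x\<in>V. norm x) < d + 1 / real (Suc n)" unfolding d_def[symmetric] by simp
    then show ?thesis using cINF_less_iff[OF assms(3) bdd] by blast
  qed
  then obtain X where X: "\<And>n. X n \<in> V" "\<And>n. norm (X n) < d + 1 / real (Suc n)" by metis
  have lim: "(\<lambda>n. norm (X n)) \<longlonglongrightarrow> d"
  proof (rule tendsto_sandwich[of "\<lambda>_. d" _ _ "\<lambda>n. d + 1 / real (Suc n)"])
    show "(\<lambda>n. d + 1 / real (Suc n)) \<longlonglongrightarrow> d"
      using tendsto_add[OF tendsto_const LIMSEQ_Suc[OF lim_1_over_n], of d] by simp
  qed (use d_le X in \<open>auto intro!: always_eventually less_imp_le simp del: of_nat_Suc\<close>)
  \<comment> \<open>Parallelogram law: the midpoint lies in the convex \<open>V\<close>, so its norm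
    is at least \<open>d\<close>, and two near-minimizers must be close to each other.\<close>
  have par: "(norm (x - y))\<^sup>2 \<le> 2 * (norm x)\<^sup>2 + 2 * (norm y)\<^sup>2 - 4 * d\<^sup>2"
    if "x \<in> V" "y \<in> V" for x y
  proof -
    have "(1/2) *\<^sub>R x + (1/2) *\<^sub>R y \<in> V" by (rule convexD[OF assms(2) that]) auto
    then have "d \<le> norm ((1/2) *\<^sub>R x + (1/2) *\<^sub>R y)" by (rule d_le)
    then have "d\<^sup>2 \<le> (norm ((1/2) *\<^sub>R x + (1/2) *\<^sub>R y))\<^sup>2" using d0 by (intro power_mono) auto
    then show ?thesis
      by (simp add: power2_norm_eq_inner inner_add_left inner_add_right inner_diff_left
          inner_diff_right inner_commute algebra_simps)
  qed
  have "Cauchy X"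
  proof (rule metric_CauchyI)
    fix e :: real assume "e > 0"
    have "(\<lambda>n. (norm (X n))\<^sup>2) \<longlonglongrightarrow> d\<^sup>2" by (intro tendsto_intros lim)
    then have "\<forall>\<^sub>F n in sequentially. (norm (X n))\<^sup>2 < d\<^sup>2 + e\<^sup>2 / 4"
      using \<open>e > 0\<close> by (intro order_tendstoD) auto
    then obtain N where N: "\<And>n. n \<ge> N \<Longrightarrow> (norm (X n))\<^sup>2 < d\<^sup>2 + e\<^sup>2 / 4"
      by (auto simp: eventually_sequentially)
    have "dist (X m) (X n) < e" if "m \<ge> N" "n \<ge> N" for m n
    proof -
      have "(norm (X m - X n))\<^sup>2 < e\<^sup>2"
        using par[OF X(1) X(1), of m n] N[OF that(1)] N[OF that(2)] by simp
      then show ?thesis using \<open>e > 0\<close> by (simp add: dist_norm power_less_imp_less_base)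
    qed
    then show "\<exists>M. \<forall>m\<ge>M. \<forall>n\<ge>M. dist (X m) (X n) < e" by blast
  qed
  then obtain m where m: "X \<longlonglongrightarrow> m" using Cauchy_convergent convergent_def by blast
  have "m \<in> V" using closed_sequentially[OF assms(1)] X(1) m by blast
  moreover have "norm m = d" using LIMSEQ_unique[OF tendsto_norm[OF m] lim] .
  ultimately show ?thesis using that d_le by simp
qed

text \<open>The chosen \<open>r\<close> minimizes the quadratic
  \<open>(norm (m + r *\<^sub>R u))\<^sup>2\<close>; there it drops below
  \<open>(norm m)\<^sup>2\<close> by \<open>(m \<bullet> u)\<^sup>2 / (u \<bullet> u)\<close>, which
  must therefore vanish.\<close>

lemma min_norm_orthogonal:
  fixes m :: "'a::real_inner"
  assumes "\<And>r. norm m \<le> norm (m + r *\<^sub>R u)"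
  shows "m \<bullet> u = 0"
proof (cases "u = 0")
  case False
  define r where "r = - (m \<bullet> u) / (u \<bullet> u)"
  have u: "u \<bullet> u > 0" using False by simp
  have "(norm m)\<^sup>2 \<le> (norm (m + r *\<^sub>R u))\<^sup>2" using assms by (intro power_mono) auto
  also have "\<dots> = (norm m)\<^sup>2 + 2 * r * (m \<bullet> u) + r * r * (u \<bullet> u)"
    by (simp only: power2_norm_eq_inner)
      (simp add: inner_add_left inner_add_right inner_commute algebra_simps)
  finally have "0 \<le> 2 * r * (m \<bullet> u) + r * (r * (u \<bullet> u))" by simp
  also have "r * (u \<bullet> u) = - (m \<bullet> u)" using u by (simp add: r_def)
  finally have "0 \<le> r * (m \<bullet> u)" by simp
  also have "\<dots> = - ((m \<bullet> u)\<^sup>2 / (u \<bullet> u))" by (simp add: r_def power2_eq_square)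
  finally have "(m \<bullet> u)\<^sup>2 / (u \<bullet> u) \<le> 0" by simp
  then show ?thesis using u by (auto simp: divide_le_0_iff)
qed auto

lemma subspace_closure:
  fixes V :: "'a::real_normed_vector set"
  assumes "subspace V"
  shows "subspace (closure V)"
proof (rule subspaceI)
  show "0 \<in> closure V" using closure_subset[of V] subspace_0[OF assms] by blast
next
  fix x y assume "x \<in> closure V" "y \<in> closure V"
  then obtain X Y where "\<And>n. X n \<in> V" "X \<longlonglongrightarrow> x" "\<And>n. Y n \<in> V" "Y \<longlonglongrightarrow> y"
    by (metis closure_sequential)
  then have "(\<lambda>n. X n + Y n) \<longlonglongrightarrow> x + y" "\<And>n. X n + Y n \<in> V"
    using assms by (auto intro: tendsto_add subspace_add)
  then show "x + y \<in> closure V" unfolding closure_sequential by metis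
next
  fix c x assume "x \<in> closure V"
  then obtain X where "\<And>n. X n \<in> V" "X \<longlonglongrightarrow> x" by (metis closure_sequential)
  then have "(\<lambda>n. c *\<^sub>R X n) \<longlonglongrightarrow> c *\<^sub>R x" "\<And>n. c *\<^sub>R X n \<in> V"
    using assms by (auto intro: tendsto_intros subspace_scale)
  then show "c *\<^sub>R x \<in> closure V" unfolding closure_sequential by metis
qed

text \<open>The shortest vector \<open>m\<close> of the translate \<open>y + V\<close> is the
  component of \<open>y\<close> orthogonal to \<open>V\<close>. The hypothesis makes it orthogonal
  to \<open>y\<close> as well, so \<open>m \<bullet> m = 0\<close> and \<open>y\<close> is in
  \<open>V\<close>.\<close>

lemma orthogonal_closed_subspace_imp_mem:
  fixes V :: "'a::{real_inner, banach} set"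
  assumes V: "closed V" "subspace V"
    and y: "\<And>m. (\<And>v. v \<in> V \<Longrightarrow> m \<bullet> v = 0) \<Longrightarrow> y \<bullet> m = 0"
  shows "y \<in> V"
proof -
  have "closed ((+) y ` V)" "convex ((+) y ` V)" "(+) y ` V \<noteq> {}"
    using V subspace_0 by (auto intro!: closed_translation convex_translation subspace_imp_convex)
  then obtain m where m: "m \<in> (+) y ` V" "\<And>x. x \<in> (+) y ` V \<Longrightarrow> norm m \<le> norm x"
    using closed_convex_min_norm by blast
  then obtain v where v: "v \<in> V" "m = y + v" by auto
  have orth: "m \<bullet> u = 0" if "u \<in> V" for u
  proof (rule min_norm_orthogonal, rule m(2))
    fix r
    have "v + r *\<^sub>R u \<in> V" using v(1) that V(2) by (simp add: subspace_add subspace_mul)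
    then show "m + r *\<^sub>R u \<in> (+) y ` V" by (auto simp: v(2) add.assoc)
  qed
  then have "y \<bullet> m = 0" by (intro y) auto
  then have "m \<bullet> m = 0" using orth[OF v(1)] by (simp add: v(2) inner_add_left inner_add_right inner_commute)
  then have "y = - v" using v(2) by (simp add: eq_neg_iff_add_eq_0)
  then show ?thesis using v(1) V(2) by (simp add: subspace_neg)
qed

text \<open>The shortest vector \<open>m\<close> of the hyperplane \<open>f x = 1\<close> is
  orthogonal to the kernel of \<open>f\<close>, and \<open>x - f x *\<^sub>R m\<close> always lies
  in that kernel.\<close>

lemma riesz_representation:
  fixes f :: "'a::{real_inner, banach} \<Rightarrow> real"
  assumes "bounded_linear f"
  obtains g where "\<And>x. f x = g \<bullet> x"
proof (cases "\<forall>x. f x = 0")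
  case True
  then show ?thesis using that[of 0] by simp
next
  case False
  interpret f: bounded_linear f by fact
  obtain x0 where x0: "f x0 \<noteq> 0" using False by auto
  let ?V = "{x. f x = 1}"
  have "closed ?V" by (intro closed_Collect_eq continuous_intros f.continuous_on)
  moreover have "convex ?V" by (auto simp: convex_def f.add f.scaleR)
  moreover have "?V \<noteq> {}" using x0 by (auto simp: f.scaleR intro!: exI[of _ "x0 /\<^sub>R f x0"])
  ultimately obtain m where "m \<in> ?V" "\<And>x. x \<in> ?V \<Longrightarrow> norm m \<le> norm x"
    by (rule closed_convex_min_norm) blast
  then have m: "f m = 1" "\<And>x. f x = 1 \<Longrightarrow> norm m \<le> norm x" by auto
  have orth: "m \<bullet> u = 0" if "f u = 0" for u
    by (rule min_norm_orthogonal, rule m(2)) (simp add: f.add f.scaleR m(1) that)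
  have "m \<noteq> 0" using m(1) f.zero by auto
  then have mm: "m \<bullet> m \<noteq> 0" by simp
  show ?thesis
  proof (rule that[of "m /\<^sub>R (m \<bullet> m)"])
    fix x
    have "m \<bullet> (x - f x *\<^sub>R m) = 0" by (rule orth) (simp add: f.diff f.scaleR m(1))
    then show "f x = (m /\<^sub>R (m \<bullet> m)) \<bullet> x" using mm by (simp add: inner_diff_right field_simps)
  qed
qed

text \<open>\<open>adjoint\<close> is a choice operator, so its defining equation holds only once a
  candidate exists; Riesz provides one pointwise in \<open>y\<close>.\<close>

lemma adjoint_inner:
  fixes f :: "'a::{real_inner, banach} \<Rightarrow> 'b::real_inner"
  assumes "bounded_linear f"
  shows "f x \<bullet> y = x \<bullet> adjoint f y"
proof -
  have "\<exists>g. \<forall>x. f x \<bullet> y = g \<bullet> x" for y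
  proof -
    have "bounded_linear (\<lambda>x. f x \<bullet> y)"
      by (rule bounded_linear_compose[OF bounded_linear_inner_left assms])
    then show ?thesis using riesz_representation by meson
  qed
  then obtain f' where "\<forall>x y. f x \<bullet> y = x \<bullet> f' y" by (metis inner_commute)
  then have "\<forall>x y. f x \<bullet> y = x \<bullet> adjoint f y"
    unfolding adjoint_def by (rule someI[where P = "\<lambda>f'. \<forall>x y. f x \<bullet> y = x \<bullet> f' y"])
  then show ?thesis by blast
qed

text \<open>If \<open>m\<close> is orthogonal to the range of a symmetric \<open>R\<close>, then
  \<open>R m \<bullet> R m = m \<bullet> R (R m) = 0\<close>; so vectors orthogonal to the kernel
  are limits of range points. This is how values of the pseudoinverse are approximated
  later.\<close>

lemma closure_range_symmetric:
  fixes R :: "'a::{real_inner, banach} \<Rightarrow> 'a"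
  assumes R: "bounded_linear R" and sym: "\<And>x y. R x \<bullet> y = x \<bullet> R y"
    and y: "\<And>m. R m = 0 \<Longrightarrow> y \<bullet> m = 0"
  shows "y \<in> closure (range R)"
proof (rule orthogonal_closed_subspace_imp_mem)
  interpret R: bounded_linear R by fact
  show "subspace (closure (range R))"
    by (rule subspace_closure) (simp add: R.linear linear_subspace_image)
  fix m assume m: "\<And>v. v \<in> closure (range R) \<Longrightarrow> m \<bullet> v = 0"
  have "R m \<bullet> R m = m \<bullet> R (R m)" by (rule sym)
  also have "\<dots> = 0" by (rule m) (use closure_subset[of "range R"] in auto)
  finally show "y \<bullet> m = 0" by (intro y) simp
qed auto

text \<open>Baire's theorem for the closed sets \<open>E n\<close>, which exhaust the space. It is
  used for the growth of the semigroup near time zero and for the boundedness of the pseudoinverse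
  composed with an operator.\<close>

lemma uniform_boundedness_principle:
  fixes F :: "('a::banach \<Rightarrow> 'b::real_normed_vector) set"
  assumes lin: "\<And>T. T \<in> F \<Longrightarrow> bounded_linear T"
    and pt: "\<And>x. \<exists>B. \<forall>T\<in>F. norm (T x) \<le> B"
  obtains M where "M \<ge> 0" "\<And>T x. T \<in> F \<Longrightarrow> norm (T x) \<le> M * norm x"
proof -
  define E where "E n = {x. \<forall>T\<in>F. norm (T x) \<le> real n}" for n
  have cl: "closed (E n)" for n
  proof -
    have "closed {x. norm (T x) \<le> real n}" if "T \<in> F" for T
      by (intro closed_Collect_le continuous_intros linear_continuous_on lin that)
    moreover have "E n = (\<Inter>T\<in>F. {x. norm (T x) \<le> real n})" by (auto simp: E_def)
    ultimately show ?thesis by auto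
  qed
  have un: "(\<Union>n. E n) = UNIV"
  proof safe
    fix x
    obtain B where B: "\<forall>T\<in>F. norm (T x) \<le> B" using pt by blast
    obtain n where "B \<le> real n" using real_arch_simple by blast
    then have "x \<in> E n" using B by (fastforce simp: E_def)
    then show "x \<in> (\<Union>n. E n)" by blast
  qed auto
  have "\<exists>n. interior (E n) \<noteq> {}"
  proof (rule ccontr)
    assume "\<not> ?thesis"
    then have "euclidean interior_of \<Union>(range E) = {}"
      by (intro Baire_category_alt) (auto simp: completely_metrizable_space_euclidean cl)
    then show False using un by simp
  qed
  then obtain n x where "x \<in> interior (E n)" by blast
  then obtain e where e: "e > 0" "cball x e \<subseteq> E n"
    by (meson mem_interior_cball)
  show ?thesis
  proof (rule that[of "2 * real n / e"])
    show "2 * real n / e \<ge> 0" using e by simp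
    fix T y assume T: "T \<in> F"
    interpret T: bounded_linear T using lin T .
    show "norm (T y) \<le> 2 * real n / e * norm y"
    proof (cases "y = 0")
      case False
      \<comment> \<open>Rescaled to length \<open>e\<close>, so that \<open>x\<close> and
        \<open>x + z\<close> both lie in \<open>E n\<close>; \<open>T z\<close> is then a difference
        of two vectors of norm at most \<open>n\<close>, whence the constant
        \<open>2 * real n / e\<close>.\<close>
      define z where "z = (e / norm y) *\<^sub>R y"
      have "norm z = e" using e False by (simp add: z_def)
      then have "x + z \<in> E n" "x \<in> E n" using e by (auto simp: dist_norm intro!: subsetD[OF e(2)])
      then have "norm (T (x + z)) \<le> n" "norm (T x) \<le> n" using T by (auto simp: E_def)
      then have "norm (T (x + z) - T x) \<le> 2 * n"
        using norm_triangle_ineq4[of "T (x + z)" "T x"] by linarith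
      then have "norm (T z) \<le> 2 * n" by (simp add: T.add)
      then have "(e / norm y) * norm (T y) \<le> 2 * n" using e by (simp add: z_def T.scaleR)
      then show ?thesis using e False by (simp add: field_simps)
    qed (simp add: T.zero)
  qed
qed

section \<open>The positive square root\<close>

definition positive_operator :: "('a \<Rightarrow> 'a::real_inner) \<Rightarrow> bool" where
  "positive_operator T \<longleftrightarrow>
     bounded_linear T \<and> (\<forall>x y. T x \<bullet> y = x \<bullet> T y) \<and> (\<forall>x. 0 \<le> T x \<bullet> x)"

lemma positive_operatorD:
  assumes "positive_operator T"
  shows "bounded_linear T" "T x \<bullet> y = x \<bullet> T y" "0 \<le> T x \<bullet> x"
  using assms by (auto simp: positive_operator_def)

text \<open>The operator inequality \<open>T \<circ> T \<le> c T\<close>, read off from the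
  quadratic form at \<open>x - T x /\<^sub>R c\<close>. This argument uses no square root of
  \<open>T\<close>, which is still to be constructed with its help.\<close>

lemma positive_operator_norm_sq:
  assumes T: "positive_operator T" and c: "c > 0" "\<And>x. norm (T x) \<le> c * norm x"
  shows "(norm (T x))\<^sup>2 \<le> c * (T x \<bullet> x)"
proof -
  interpret T: bounded_linear T using positive_operatorD(1)[OF T] .
  have sym: "T x \<bullet> y = x \<bullet> T y" for x y using positive_operatorD(2)[OF T] .
  define y where "y = T x"
  have "T y \<bullet> y \<le> norm (T y) * norm y" by (rule norm_cauchy_schwarz)
  also have "\<dots> \<le> c * norm y * norm y" by (intro mult_right_mono c) auto
  finally have Ty: "T y \<bullet> y \<le> c * (y \<bullet> y)" by (simp add: dot_square_norm power2_eq_square)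
  have "0 \<le> T (x - y /\<^sub>R c) \<bullet> (x - y /\<^sub>R c)" using positive_operatorD(3)[OF T] .
  also have "\<dots> = T x \<bullet> x - 2 / c * (y \<bullet> y) + (T y \<bullet> y) / c\<^sup>2"
    using c sym[of y x]
    by (simp add: T.diff T.scaleR inner_diff_left inner_diff_right y_def[symmetric] inner_commute
        power2_eq_square field_simps)
  also have "\<dots> \<le> T x \<bullet> x - 2 / c * (y \<bullet> y) + (c * (y \<bullet> y)) / c\<^sup>2"
    using Ty by (intro add_left_mono divide_right_mono) auto
  also have "\<dots> = T x \<bullet> x - (y \<bullet> y) / c" using c by (simp add: power2_eq_square field_simps)
  finally show ?thesis using c by (simp add: y_def dot_square_norm field_simps)
qed

lemma positive_operator_bound:
  assumes "positive_operator T"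
  obtains c where "c > 0" "\<And>x. norm (T x) \<le> c * norm x"
  using bounded_linear.pos_bounded[OF positive_operatorD(1)[OF assms]] by (metis mult.commute)

lemma positive_operator_kernel:
  assumes T: "positive_operator T" and "T x \<bullet> x = 0"
  shows "T x = 0"
proof -
  obtain c where "c > 0" "\<And>x. norm (T x) \<le> c * norm x" using positive_operator_bound[OF T] by blast
  from positive_operator_norm_sq[OF T this, of x] show ?thesis using assms(2) by simp
qed

text \<open>With \<open>B = I - T / c\<close>, the square root is \<open>\<surd>c (I - Y)\<close>, where \<open>Y = (B + Y\<^sup>2) / 2\<close>.
  The increments of the operator iteration are dominated by those of the scalar iteration for
  \<open>B = 1\<close>, which increases to \<open>1\<close>.\<close>

fun sqrt_iter :: "('a \<Rightarrow>\<^sub>L 'a) \<Rightarrow> nat \<Rightarrow> ('a::real_normed_vector \<Rightarrow>\<^sub>L 'a)" where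
  "sqrt_iter B 0 = 0"
| "sqrt_iter B (Suc n) = (B + (sqrt_iter B n o\<^sub>L sqrt_iter B n)) /\<^sub>R 2"

fun sqrt_iter_bound :: "nat \<Rightarrow> real" where
  "sqrt_iter_bound 0 = 0"
| "sqrt_iter_bound (Suc n) = (1 + (sqrt_iter_bound n)\<^sup>2) / 2"

lemma sqrt_iter_bound_01: "0 \<le> sqrt_iter_bound n \<and> sqrt_iter_bound n \<le> 1"
proof (induction n)
  case (Suc n)
  then have "(sqrt_iter_bound n)\<^sup>2 \<le> 1" by (simp add: power_le_one)
  then show ?case by simp
qed simp

lemma sqrt_iter_bound_mono: "sqrt_iter_bound n \<le> sqrt_iter_bound (Suc n)"
proof -
  have "0 \<le> (1 - sqrt_iter_bound n)\<^sup>2" by simp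
  then show ?thesis by (simp add: power2_eq_square algebra_simps)
qed

lemma norm_sqrt_iter:
  assumes "norm B \<le> 1"
  shows "norm (sqrt_iter B n) \<le> sqrt_iter_bound n"
proof (induction n)
  case (Suc n)
  have "norm (sqrt_iter B (Suc n)) = norm (B + (sqrt_iter B n o\<^sub>L sqrt_iter B n)) / 2" by simp
  also have "\<dots> \<le> (norm B + norm (sqrt_iter B n o\<^sub>L sqrt_iter B n)) / 2"
    by (intro divide_right_mono norm_triangle_ineq) simp
  also have "\<dots> \<le> (1 + sqrt_iter_bound n * sqrt_iter_bound n) / 2"
    using Suc assms sqrt_iter_bound_01[of n]
    by (intro divide_right_mono add_mono order_trans[OF norm_blinfun_compose] mult_mono) auto
  finally show ?case by (simp add: power2_eq_square)
qed simp

lemma norm_sqrt_iter_diff: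
  assumes "norm B \<le> 1"
  shows "norm (sqrt_iter B (Suc n) - sqrt_iter B n) \<le> sqrt_iter_bound (Suc n) - sqrt_iter_bound n"
proof (induction n)
  case 0
  then show ?case using assms by simp
next
  case (Suc n)
  let ?Y = "sqrt_iter B (Suc n)" and ?Z = "sqrt_iter B n"
  let ?y = "sqrt_iter_bound (Suc n)" and ?z = "sqrt_iter_bound n"
  \<comment> \<open>This way of splitting the difference of two squares is valid without
    commutativity, and in norm it reproduces the scalar identity
    \<open>y\<^sup>2 - z\<^sup>2 = y (y - z) + (y - z) z\<close> exactly.\<close>
  have "sqrt_iter B (Suc (Suc n)) - ?Y = ((?Y o\<^sub>L (?Y - ?Z)) + ((?Y - ?Z) o\<^sub>L ?Z)) /\<^sub>R 2"
  proof -
    have "?Y = (B + (?Z o\<^sub>L ?Z)) /\<^sub>R 2" "sqrt_iter B (Suc (Suc n)) = (B + (?Y o\<^sub>L ?Y)) /\<^sub>R 2"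
      by (rule sqrt_iter.simps)+
    then have "sqrt_iter B (Suc (Suc n)) - ?Y = ((?Y o\<^sub>L ?Y) - (?Z o\<^sub>L ?Z)) /\<^sub>R 2"
      by (metis (no_types) add_diff_cancel_left scaleR_right_diff_distrib)
    also have "(?Y o\<^sub>L ?Y) - (?Z o\<^sub>L ?Z) = (?Y o\<^sub>L (?Y - ?Z)) + ((?Y - ?Z) o\<^sub>L ?Z)"
      by (rule blinfun_eqI) (simp add: blinfun.add_left blinfun.diff_left blinfun.diff_right del: sqrt_iter.simps)
    finally show ?thesis .
  qed
  then have "norm (sqrt_iter B (Suc (Suc n)) - ?Y) =
      norm ((?Y o\<^sub>L (?Y - ?Z)) + ((?Y - ?Z) o\<^sub>L ?Z)) / 2"
    by (simp del: sqrt_iter.simps)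
  also have "\<dots> \<le> (norm (?Y o\<^sub>L (?Y - ?Z)) + norm ((?Y - ?Z) o\<^sub>L ?Z)) / 2"
    by (intro divide_right_mono norm_triangle_ineq) auto
  also have "\<dots> \<le> (?y * (?y - ?z) + (?y - ?z) * ?z) / 2"
    using Suc norm_sqrt_iter[OF assms] sqrt_iter_bound_01 sqrt_iter_bound_mono[of n]
    by (intro divide_right_mono add_mono order_trans[OF norm_blinfun_compose] mult_mono)
      (auto simp del: sqrt_iter.simps sqrt_iter_bound.simps)
  also have "\<dots> = (?y\<^sup>2 - ?z\<^sup>2) / 2" by (simp only: power2_eq_square) (simp add: algebra_simps)
  also have "\<dots> = sqrt_iter_bound (Suc (Suc n)) - ?y"
    by (subst (2) sqrt_iter_bound.simps, subst (3) sqrt_iter_bound.simps) (simp add: field_simps)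
  finally show ?case .
qed

text \<open>The scalar increments telescope to a convergent series because the scalar sequence is
  monotone and bounded. Domination then gives absolute convergence in operator norm, and continuity
  of composition passes the recursion to the limit.\<close>

lemma sqrt_iter_convergent:
  fixes B :: "'a::banach \<Rightarrow>\<^sub>L 'a"
  assumes B: "norm B \<le> 1"
  obtains Y where "sqrt_iter B \<longlonglongrightarrow> Y" "norm Y \<le> 1" "Y = (B + (Y o\<^sub>L Y)) /\<^sub>R 2"
proof -
  have "incseq sqrt_iter_bound" by (rule incseq_SucI) (rule sqrt_iter_bound_mono)
  then have "convergent sqrt_iter_bound"
    using sqrt_iter_bound_01 by (metis convergentI incseq_convergent)
  then have "summable (\<lambda>n. sqrt_iter_bound (Suc n) - sqrt_iter_bound n)"
    using telescope_summable convergent_LIMSEQ_iff by blast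
  then have "summable (\<lambda>n. sqrt_iter B (Suc n) - sqrt_iter B n)"
    by (rule summable_comparison_test'[where N=0]) (rule norm_sqrt_iter_diff[OF B])
  then have "convergent (sqrt_iter B)" unfolding summable_iff_convergent sum_lessThan_telescope by simp
  then obtain Y where Y: "sqrt_iter B \<longlonglongrightarrow> Y" by (auto simp: convergent_def)
  have le: "norm (sqrt_iter B n) \<le> 1" for n
    using norm_sqrt_iter[OF B, of n] sqrt_iter_bound_01[of n] by linarith
  have "norm Y \<le> 1"
    by (rule Lim_bounded[OF tendsto_norm[OF Y]]) (use le in auto)
  moreover have "(\<lambda>n. sqrt_iter B (Suc n)) \<longlonglongrightarrow> (B + (Y o\<^sub>L Y)) /\<^sub>R 2"
    unfolding sqrt_iter.simps
    by (intro tendsto_intros bounded_bilinear.tendsto[OF bounded_bilinear_blinfun_compose] Y)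
  then have "Y = (B + (Y o\<^sub>L Y)) /\<^sub>R 2" using LIMSEQ_unique LIMSEQ_Suc[OF Y] by blast
  ultimately show ?thesis using that Y by blast
qed

text \<open>The predicate under the \<open>THE\<close> of \<open>op_sqrt\<close>, isolated so that
  existence and uniqueness can be treated separately.\<close>

definition is_op_sqrt :: "('a \<Rightarrow> 'a::real_inner) \<Rightarrow> ('a \<Rightarrow> 'a) \<Rightarrow> bool" where
  "is_op_sqrt T R \<longleftrightarrow> positive_operator R \<and> R \<circ> R = T"

text \<open>The commutation clause prepares uniqueness. It holds because each iterate is a
  polynomial in \<open>B\<close>, hence in \<open>T\<close>, and the pointwise limit inherits
  commutation.\<close>

lemma positive_operator_has_sqrt:
  fixes T :: "'a::{real_inner, banach} \<Rightarrow> 'a"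
  assumes T: "positive_operator T"
  obtains R where "is_op_sqrt T R"
    "\<And>V. bounded_linear V \<Longrightarrow> V \<circ> T = T \<circ> V \<Longrightarrow> V \<circ> R = R \<circ> V"
proof -
  obtain c where c: "c > 0" "\<And>x. norm (T x) \<le> c * norm x" using positive_operator_bound[OF T] by blast
  interpret T: bounded_linear T using positive_operatorD(1)[OF T] .
  define B where "B = Blinfun (\<lambda>x. x - T x /\<^sub>R c)"
  have B: "blinfun_apply B x = x - T x /\<^sub>R c" for x
    unfolding B_def by (subst bounded_linear_Blinfun_apply)
      (auto intro!: bounded_linear_intros T.bounded_linear)
  have "norm (blinfun_apply B x) \<le> norm x" for x
  proof -
    have "(norm (blinfun_apply B x))\<^sup>2 = x \<bullet> x - 2 / c * (T x \<bullet> x) + (T x \<bullet> T x) / c\<^sup>2"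
      using c(1) unfolding power2_norm_eq_inner B
      by (simp add: inner_diff_left inner_diff_right inner_commute field_simps power2_eq_square)
    also have "\<dots> \<le> x \<bullet> x - 2 / c * (T x \<bullet> x) + (c * (T x \<bullet> x)) / c\<^sup>2"
      using positive_operator_norm_sq[OF T c, of x]
      by (intro add_left_mono divide_right_mono) (auto simp: dot_square_norm)
    also have "\<dots> = x \<bullet> x - (T x \<bullet> x) / c" using c by (simp add: power2_eq_square field_simps)
    also have "\<dots> \<le> (norm x)\<^sup>2" using c positive_operatorD(3)[OF T] by (simp add: power2_norm_eq_inner)
    finally show ?thesis by (rule power2_le_imp_le) simp
  qed
  then have "norm B \<le> 1" by (intro norm_blinfun_bound) auto
  then obtain Y where Y: "sqrt_iter B \<longlonglongrightarrow> Y" "norm Y \<le> 1" "Y = (B + (Y o\<^sub>L Y)) /\<^sub>R 2"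
    using sqrt_iter_convergent by blast
  have Yx: "(\<lambda>n. blinfun_apply (sqrt_iter B n) x) \<longlonglongrightarrow> blinfun_apply Y x" for x
    by (intro blinfun.tendsto Y tendsto_const)
  have YY: "2 *\<^sub>R blinfun_apply Y x = x - T x /\<^sub>R c + blinfun_apply Y (blinfun_apply Y x)" for x
  proof -
    have "2 *\<^sub>R Y = B + (Y o\<^sub>L Y)" by (subst Y(3)) simp
    then have "2 *\<^sub>R blinfun_apply Y x = blinfun_apply (B + (Y o\<^sub>L Y)) x"
      by (metis blinfun.scaleR_left)
    then show ?thesis by (simp add: B blinfun.add_left)
  qed
  have iter_sym: "blinfun_apply (sqrt_iter B n) x \<bullet> y = x \<bullet> blinfun_apply (sqrt_iter B n) y" for n x y
  proof (induction n arbitrary: x y)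
    case (Suc n)
    then show ?case
      using positive_operatorD(2)[OF T]
      by (simp add: blinfun.scaleR_left blinfun.add_left inner_add_left inner_add_right B
          inner_diff_left inner_diff_right)
  qed simp
  have Y_sym: "blinfun_apply Y x \<bullet> y = x \<bullet> blinfun_apply Y y" for x y
  proof (rule LIMSEQ_unique)
    show "(\<lambda>n. blinfun_apply (sqrt_iter B n) x \<bullet> y) \<longlonglongrightarrow> blinfun_apply Y x \<bullet> y"
      by (intro tendsto_intros Yx)
    show "(\<lambda>n. blinfun_apply (sqrt_iter B n) x \<bullet> y) \<longlonglongrightarrow> x \<bullet> blinfun_apply Y y"
      unfolding iter_sym by (intro tendsto_intros Yx)
  qed
  \<comment> \<open>The fixed point equation says \<open>(I - Y)\<^sup>2 = I - B = T / c\<close>;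
    positivity of \<open>I - Y\<close> comes from \<open>norm Y \<le> 1\<close>.\<close>
  define R where "R x = sqrt c *\<^sub>R (x - blinfun_apply Y x)" for x
  have Rlin: "bounded_linear R" unfolding R_def by (intro bounded_linear_intros)
  have "0 \<le> R x \<bullet> x" for x
  proof -
    have "blinfun_apply Y x \<bullet> x \<le> norm (blinfun_apply Y x) * norm x" by (rule norm_cauchy_schwarz)
    also have "\<dots> \<le> (norm Y * norm x) * norm x" by (intro mult_right_mono norm_blinfun) auto
    also have "\<dots> \<le> (1 * norm x) * norm x" by (intro mult_right_mono Y) auto
    finally show ?thesis using c by (simp add: R_def inner_diff_left dot_square_norm power2_eq_square)
  qed
  moreover have "R x \<bullet> y = x \<bullet> R y" for x y
    by (simp add: R_def inner_diff_left inner_diff_right Y_sym)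
  moreover have "R \<circ> R = T"
  proof
    fix x
    have "R (R x) = c *\<^sub>R (x - 2 *\<^sub>R blinfun_apply Y x + blinfun_apply Y (blinfun_apply Y x))"
      using c by (simp add: R_def blinfun.scaleR_right blinfun.diff_right algebra_simps scaleR_2
          flip: real_sqrt_mult)
    then show "(R \<circ> R) x = T x" using c by (simp add: YY)
  qed
  ultimately have "is_op_sqrt T R" using Rlin by (simp add: is_op_sqrt_def positive_operator_def)
  moreover have "V \<circ> R = R \<circ> V" if V: "bounded_linear V" and VT: "V \<circ> T = T \<circ> V" for V
  proof -
    interpret V: bounded_linear V by fact
    have VT': "V (T x) = T (V x)" for x using VT by (metis comp_apply)
    have iter: "V (blinfun_apply (sqrt_iter B n) x) = blinfun_apply (sqrt_iter B n) (V x)" for n x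
    proof (induction n arbitrary: x)
      case (Suc n)
      then show ?case
        by (simp add: blinfun.scaleR_left blinfun.add_left V.add V.scaleR V.diff B VT')
    qed (simp add: V.zero)
    have "V (blinfun_apply Y x) = blinfun_apply Y (V x)" for x
    proof (rule LIMSEQ_unique)
      show "(\<lambda>n. V (blinfun_apply (sqrt_iter B n) x)) \<longlonglongrightarrow> V (blinfun_apply Y x)"
        by (intro V.tendsto Yx)
      show "(\<lambda>n. V (blinfun_apply (sqrt_iter B n) x)) \<longlonglongrightarrow> blinfun_apply Y (V x)"
        unfolding iter by (rule Yx)
    qed
    then show ?thesis by (auto simp: R_def V.scaleR V.diff fun_eq_iff)
  qed
  ultimately show ?thesis using that by blast
qed

text \<open>Any root \<open>V\<close> commutes with \<open>T\<close>, hence with the constructed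
  \<open>R\<close>, so \<open>(V + R) (V - R) = 0\<close>. With \<open>y = V x - R x\<close>,
  positivity splits \<open>V y + R y = 0\<close> into \<open>V y = 0\<close> and
  \<open>R y = 0\<close>, and moving \<open>V\<close> and \<open>R\<close> across the inner product
  gives \<open>y \<bullet> y = 0\<close>.\<close>

lemma is_op_sqrt_unique:
  fixes T :: "'a::{real_inner, banach} \<Rightarrow> 'a"
  assumes T: "positive_operator T" and R1: "is_op_sqrt T R1" and R2: "is_op_sqrt T R2"
  shows "R1 = R2"
proof -
  obtain R where R: "is_op_sqrt T R"
    and comm: "\<And>V. bounded_linear V \<Longrightarrow> V \<circ> T = T \<circ> V \<Longrightarrow> V \<circ> R = R \<circ> V"
    using positive_operator_has_sqrt[OF T] by blast
  have "V = R" if V: "is_op_sqrt T V" for V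
  proof
    fix x
    have pos: "positive_operator V" "positive_operator R"
      using V R by (auto simp: is_op_sqrt_def)
    interpret V: bounded_linear V using positive_operatorD(1)[OF pos(1)] .
    interpret R: bounded_linear R using positive_operatorD(1)[OF pos(2)] .
    have sq: "V (V x) = T x" "R (R x) = T x" for x
      using V R by (auto simp: is_op_sqrt_def fun_eq_iff)
    have "V \<circ> T = T \<circ> V" using sq by (auto simp: fun_eq_iff simp flip: sq(1))
    then have "V \<circ> R = R \<circ> V" by (intro comm V.bounded_linear)
    then have VR: "V (R x) = R (V x)" for x by (metis comp_apply)
    define y where "y = V x - R x"
    have "V y + R y = 0" by (simp add: y_def V.diff R.diff VR sq)
    then have "V y \<bullet> y + R y \<bullet> y = 0" by (metis inner_add_left inner_zero_left)
    then have "V y \<bullet> y = 0" "R y \<bullet> y = 0"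
      using positive_operatorD(3)[OF pos(1), of y] positive_operatorD(3)[OF pos(2), of y] by linarith+
    then have "V y = 0" "R y = 0" using positive_operator_kernel pos by blast+
    then have "y \<bullet> y = 0"
      using positive_operatorD(2)[OF pos(1), of x y] positive_operatorD(2)[OF pos(2), of x y]
      by (subst y_def) (simp add: inner_diff_left)
    then show "V x = R x" by (simp add: y_def)
  qed
  then show ?thesis using R1 R2 by blast
qed

lemma op_sqrt_is_op_sqrt:
  fixes T :: "'a::{real_inner, banach} \<Rightarrow> 'a"
  assumes T: "positive_operator T"
  shows "is_op_sqrt T (op_sqrt T)"
proof -
  obtain R where R: "is_op_sqrt T R" using positive_operator_has_sqrt[OF T] by blast
  have "op_sqrt T = (THE R. is_op_sqrt T R)"
    by (simp add: op_sqrt_def is_op_sqrt_def positive_operator_def conj_assoc)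
  also have "\<dots> = R" using is_op_sqrt_unique[OF T] R by blast
  finally show ?thesis using R by simp
qed

section \<open>Density of trigonometric polynomials\<close>

text \<open>The phase \<open>b\<close> covers sines as well and absorbs translations of the
  argument, so the class is stable under every operation that follows while induction has a single
  base case.\<close>

inductive trig_poly :: "('a::real_inner \<Rightarrow> real) \<Rightarrow> bool" where
  cos: "trig_poly (\<lambda>z. a * cos (u \<bullet> z + b))"
| add: "trig_poly p \<Longrightarrow> trig_poly q \<Longrightarrow> trig_poly (\<lambda>z. p z + q z)"

lemma trig_poly_const: "trig_poly (\<lambda>z. c)"
  using trig_poly.cos[of c 0 0] by simp

lemma trig_poly_scale: "trig_poly p \<Longrightarrow> trig_poly (\<lambda>z. c * p z)"
proof (induction rule: trig_poly.induct)
  case (cos a u b)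
  then show ?case using trig_poly.cos[of "c * a" u b] by (simp add: mult.assoc)
next
  case (add p q)
  then show ?case using trig_poly.add by (simp add: distrib_left)
qed

text \<open>Product-to-sum formula for two cosines, extended by distributivity in each factor.
  Stone-Weierstrass asks for an algebra.\<close>

lemma trig_poly_mult:
  assumes "trig_poly p" "trig_poly q"
  shows "trig_poly (\<lambda>z. p z * q z)"
  using assms
proof (induction arbitrary: q rule: trig_poly.induct)
  case (cos a u b)
  from cos show ?case
  proof (induction rule: trig_poly.induct)
    case (cos a' u' b')
    have "trig_poly (\<lambda>z. (a * a' / 2) * cos ((u - u') \<bullet> z + (b - b'))
        + (a * a' / 2) * cos ((u + u') \<bullet> z + (b + b')))"
      by (intro trig_poly.intros)
    moreover have "(a * a' / 2) * cos ((u - u') \<bullet> z + (b - b'))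
        + (a * a' / 2) * cos ((u + u') \<bullet> z + (b + b')) =
        (a * cos (u \<bullet> z + b)) * (a' * cos (u' \<bullet> z + b'))" for z
    proof -
      have "(u - u') \<bullet> z + (b - b') = (u \<bullet> z + b) - (u' \<bullet> z + b')"
        "(u + u') \<bullet> z + (b + b') = (u \<bullet> z + b) + (u' \<bullet> z + b')"
        by (simp_all add: inner_diff_left inner_add_left)
      then show ?thesis by (simp only: cos_diff cos_add) (simp add: field_simps)
    qed
    ultimately show ?case by simp
  next
    case (add p q)
    then show ?case using trig_poly.add by (simp add: distrib_left)
  qed
next
  case (add p q')
  show ?case
    using trig_poly.add[OF add.IH(1)[OF add.prems] add.IH(2)[OF add.prems]]
    by (simp add: distrib_right)
qed

lemma trig_poly_continuous_on: "trig_poly p \<Longrightarrow> continuous_on S p"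
  by (induction rule: trig_poly.induct) (auto intro!: continuous_intros)

lemma trig_poly_borel_measurable [measurable]: "trig_poly p \<Longrightarrow> p \<in> borel_measurable borel"
  by (intro borel_measurable_continuous_onI trig_poly_continuous_on)

lemma trig_poly_bounded:
  assumes "trig_poly p"
  obtains M where "\<And>z. \<bar>p z\<bar> \<le> M"
proof -
  have "\<exists>M. \<forall>z. \<bar>p z\<bar> \<le> M"
    using assms
  proof (induction rule: trig_poly.induct)
    case (cos a u b)
    have "\<bar>a * cos (u \<bullet> z + b)\<bar> \<le> \<bar>a\<bar> * 1" for z
      unfolding abs_mult by (intro mult_left_mono) auto
    then show ?case by blast
  next
    case (add p q)
    then obtain M N where "\<forall>z. \<bar>p z\<bar> \<le> M" "\<forall>z. \<bar>q z\<bar> \<le> N" by blast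
    then have "\<bar>p z + q z\<bar> \<le> M + N" for z using abs_triangle_ineq[of "p z" "q z"] add_mono order_trans by blast
    then show ?case by blast
  qed
  then show ?thesis using that by blast
qed

lemma trig_poly_separates:
  assumes "x \<noteq> y"
  shows "\<exists>p. trig_poly p \<and> p x \<noteq> p y"
proof -
  define u where "u = (x - y) /\<^sub>R ((x - y) \<bullet> (x - y))"
  \<comment> \<open>The phase turns the cosine into \<open>sin (u \<bullet> (z - y))\<close>, and
    \<open>u\<close> is normalized by \<open>u \<bullet> (x - y) = 1\<close>: the two values are
    \<open>sin 1\<close> and \<open>0\<close>.\<close>
  define p where "p z = 1 * cos (u \<bullet> z + (- pi / 2 - u \<bullet> y))" for z
  have p: "p z = sin (u \<bullet> (z - y))" for z
  proof -
    have "u \<bullet> z + (- pi / 2 - u \<bullet> y) = u \<bullet> (z - y) - pi / 2" by (simp add: inner_diff_right)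
    then show ?thesis by (simp only: p_def cos_diff) simp
  qed
  have "u \<bullet> (x - y) = 1" using assms by (simp add: u_def)
  then have "p x = sin 1" "p y = 0" using p by simp_all
  moreover have "sin 1 > (0::real)" using pi_gt3 by (intro sin_gt_zero) auto
  moreover have "trig_poly p" unfolding p_def by (rule trig_poly.cos)
  ultimately show ?thesis by (intro exI[of _ p]) simp
qed

lemma trig_poly_approx_on_compact:
  fixes f :: "'a::real_inner \<Rightarrow> real"
  assumes "compact K" "continuous_on K f" "e > 0"
  obtains p where "trig_poly p" "\<And>x. x \<in> K \<Longrightarrow> \<bar>f x - p x\<bar> < e"
proof -
  have "\<exists>p. trig_poly p \<and> (\<forall>x\<in>K. \<bar>f x - p x\<bar> < e)"
    by (rule Stone_Weierstrass_HOL[of K trig_poly])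
      (use assms trig_poly_separates in \<open>auto intro: trig_poly_const trig_poly_continuous_on
        trig_poly.add trig_poly_mult\<close>)
  then show ?thesis using that by blast
qed

text \<open>An approximation on a compact set says nothing about the size elsewhere; truncation
  repairs this. To stay within the class on the whole space, Stone-Weierstrass is applied on the
  interval \<open>{-B..B}\<close> that contains all values of \<open>p\<close>, to the algebra of
  those \<open>g\<close> for which \<open>g (p z)\<close> is again a trigonometric
  polynomial.\<close>

lemma trig_poly_approx_clamp:
  assumes p: "trig_poly p" and e: "e > 0"
  obtains q where "trig_poly q" "\<And>z. \<bar>max (- M) (min M (p z)) - q z\<bar> < e"
proof -
  obtain B where B: "\<And>z. \<bar>p z\<bar> \<le> B" using trig_poly_bounded[OF p] by blast
  let ?P = "\<lambda>g. continuous_on {-B..B} g \<and> trig_poly (\<lambda>z. g (p z))"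
  have "\<exists>g. ?P g \<and> (\<forall>x\<in>{-B..B}. \<bar>max (- M) (min M x) - g x\<bar> < e)"
  proof (rule Stone_Weierstrass_HOL[of _ ?P])
    fix x y :: real assume "x \<in> {-B..B} \<and> y \<in> {-B..B} \<and> x \<noteq> y"
    then show "\<exists>f. ?P f \<and> f x \<noteq> f y" by (intro exI[of _ "\<lambda>x. x"]) (auto simp: p)
  qed (use e in \<open>auto intro!: continuous_intros intro: trig_poly_const trig_poly.add trig_poly_mult\<close>)
  then obtain g where g: "trig_poly (\<lambda>z. g (p z))"
      "\<And>x. x \<in> {-B..B} \<Longrightarrow> \<bar>max (- M) (min M x) - g x\<bar> < e" by blast
  show ?thesis
    by (rule that[OF g(1)], rule g(2)) (use B in \<open>auto simp: abs_le_iff minus_le_iff\<close>)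
qed

section \<open>Approximation in the mean for finite Borel measures\<close>

lemma inner_regular_compact:
  fixes M :: "'a::{second_countable_topology, complete_space} measure"
  assumes "finite_measure M" and "sets M = sets borel" "B \<in> sets borel" "e > 0"
  obtains K where "K \<subseteq> B" "compact K" "measure M (B - K) < e"
proof -
  interpret finite_measure M by fact
  have fin: "emeasure M (space M) \<noteq> \<infinity>" by simp
  have "\<exists>K. K \<subseteq> B \<and> compact K \<and> measure M (B - K) < e"
  \<comment> \<open>The case distinction keeps \<open>measure M B - e\<close> nonnegative, since
    \<open>ennreal\<close> truncates negative reals.\<close>
  proof (cases "measure M B < e")
    case True
    then show ?thesis by (intro exI[of _ "{}"]) auto
  next
    case False
    have "emeasure M B > ennreal (measure M B - e)"
      using False assms(4) by (simp add: emeasure_eq_measure ennreal_less_iff)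
    then obtain K where K: "K \<subseteq> B" "compact K" "ennreal (measure M B - e) < emeasure M K"
      unfolding inner_regular[OF assms(2) fin assms(3)] less_SUP_iff by blast
    have "K \<in> sets M" using K(2) assms(2) by (simp add: borel_compact)
    moreover have "B \<in> sets M" using assms by simp
    ultimately have "measure M (B - K) < e"
      using K False by (simp add: finite_measure_Diff emeasure_eq_measure ennreal_less_iff)
    then show ?thesis using K by blast
  qed
  then show ?thesis using that by blast
qed

lemma integrable_trig_poly:
  assumes "finite_measure M" and "sets M = sets borel" "trig_poly p"
  shows "integrable M p"
proof -
  interpret finite_measure M by fact
  obtain B where "\<And>z. \<bar>p z\<bar> \<le> B" using trig_poly_bounded[OF assms(3)] by blast
  moreover have "p \<in> borel_measurable M"
    using trig_poly_borel_measurable[OF assms(3)] assms(2) by (simp cong: measurable_cong_sets)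
  ultimately show ?thesis by (intro integrable_const_bound[of _ B]) auto
qed

text \<open>Compact sets \<open>K\<close> inside \<open>B\<close> and \<open>L\<close> inside its
  complement are disjoint, so the indicator is continuous on their union and can be approximated
  there; the truncation controls the small remainder.\<close>

lemma trig_poly_approx_indicator:
  fixes M :: "'a::{real_inner, second_countable_topology, banach} measure"
  assumes fin: "finite_measure M" and M: "sets M = sets borel" and B: "B \<in> sets borel" and e: "e > 0"
  obtains p where "trig_poly p" "(\<integral>z. \<bar>indicator B z - p z\<bar> \<partial>M) < e"
proof -
  interpret finite_measure M by fact
  \<comment> \<open>The error is at most \<open>2 * d\<close> on \<open>K \<union> L\<close> and at
    most 3 on the remainder, whose measure is below \<open>2 * d\<close>; the total is
    \<open>d * (2 * measure M (space M) + 6)\<close>, and 7 makes the inequality strict. The cap at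
    1 gives \<open>\<bar>p z\<bar> \<le> 2\<close>.\<close>
  define d where "d = min 1 (e / (2 * measure M (space M) + 7))"
  have den: "2 * measure M (space M) + 7 > 0" by (simp add: add_nonneg_pos)
  then have d: "d > 0" "d \<le> 1" using e by (auto simp: d_def)
  obtain K where K: "K \<subseteq> B" "compact K" "measure M (B - K) < d"
    using inner_regular_compact[OF fin M B d(1)] .
  obtain L where L: "L \<subseteq> - B" "compact L" "measure M (- B - L) < d"
    using inner_regular_compact[OF fin M borel_comp[OF B] d(1)] .
  have disj: "K \<inter> L = {}" using K L by blast
  have "continuous_on (K \<union> L) (\<lambda>x. if x \<in> K then 1 else 0 :: real)"
    by (rule continuous_on_If) (use K L disj in \<open>auto intro: compact_imp_closed\<close>)
  then obtain p0 where p0: "trig_poly p0"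
      "\<And>x. x \<in> K \<union> L \<Longrightarrow> \<bar>(if x \<in> K then 1 else 0) - p0 x\<bar> < d"
    using trig_poly_approx_on_compact[OF compact_Un[OF K(2) L(2)] _ d(1)] by metis
  obtain p where p: "trig_poly p" "\<And>z. \<bar>max (- 1) (min 1 (p0 z)) - p z\<bar> < d"
    using trig_poly_approx_clamp[OF p0(1) d(1)] by blast
  let ?N = "(B - K) \<union> (- B - L)"
  have meas: "K \<in> sets M" "L \<in> sets M" "B \<in> sets M"
    using K L B M by (auto simp: borel_compact)
  then have N: "B - K \<in> sets M" "- B - L \<in> sets M"
    using borel_comp[OF B] M by auto
  then have "?N \<in> sets M" by auto
  note N = N this
  have bound: "\<bar>indicator B z - p z\<bar> \<le> 2 * d + 3 * indicator ?N z" for z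
  proof (cases "z \<in> K \<union> L")
    case True
    then have "indicator B z = (if z \<in> K then 1 else 0 :: real)" using K L by auto
    then show ?thesis using p0(2)[OF True] p(2)[of z] d by (auto simp: indicator_def split: if_splits)
  next
    case False
    then have "z \<in> ?N" by auto
    moreover have "\<bar>p z\<bar> \<le> 2" using p(2)[of z] d by linarith
    ultimately show ?thesis using d by (auto simp: indicator_def)
  qed
  have "(\<integral>z. \<bar>indicator B z - p z\<bar> \<partial>M) \<le> (\<integral>z. 2 * d + 3 * indicator ?N z \<partial>M)"
    using meas N integrable_trig_poly[OF fin M p(1)]
    by (intro integral_mono bound integrable_abs Bochner_Integration.integrable_diff
        Bochner_Integration.integrable_add integrable_mult_right integrable_const integrable_real_indicator)
       (auto simp: emeasure_eq_measure)
  also have "\<dots> = 2 * d * measure M (space M) + 3 * measure M ?N"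
    using N by (simp add: emeasure_eq_measure)
  also have "\<dots> \<le> 2 * d * measure M (space M) + 6 * d"
    using measure_Un_le[OF N(1,2)] K L by simp
  also have "\<dots> < d * (2 * measure M (space M) + 7)"
    using d by (simp add: algebra_simps)
  also have "\<dots> \<le> e" using den by (simp add: d_def min_mult_distrib_right)
  finally show ?thesis using that p(1) by simp
qed

lemma trig_poly_approx_integrable:
  fixes M :: "'a::{real_inner, second_countable_topology, banach} measure"
  assumes fin: "finite_measure M" and M: "sets M = sets borel" and f: "integrable M f" and e: "e > 0"
  shows "\<exists>p. trig_poly p \<and> (\<integral>z. \<bar>f z - p z\<bar> \<partial>M) < e"
proof -
  interpret finite_measure M by fact
  show ?thesis
    using f e
  proof (induction arbitrary: e rule: integrable_induct)
    case (base A c)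
    define d where "d = e / (\<bar>c\<bar> + 1)"
    have "d > 0" using base by (simp add: d_def)
    then obtain p where p: "trig_poly p" "(\<integral>z. \<bar>indicator A z - p z\<bar> \<partial>M) < d"
      using trig_poly_approx_indicator[OF fin M] base(1) M by metis
    have "(\<integral>z. \<bar>indicator A z *\<^sub>R c - c * p z\<bar> \<partial>M) = (\<integral>z. \<bar>c\<bar> * \<bar>indicator A z - p z\<bar> \<partial>M)"
      by (intro Bochner_Integration.integral_cong) (auto simp: abs_mult[symmetric] algebra_simps)
    also have "\<dots> = \<bar>c\<bar> * (\<integral>z. \<bar>indicator A z - p z\<bar> \<partial>M)" by simp
    also have "\<dots> \<le> \<bar>c\<bar> * d" using p by (intro mult_left_mono) auto
    also have "\<dots> < (\<bar>c\<bar> + 1) * d" using \<open>d > 0\<close> by simp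
    also have "\<dots> = e" by (simp add: d_def)
    finally show ?case using trig_poly_scale[OF p(1)] by blast
  next
    case (add f g)
    obtain p q where p: "trig_poly p" "(\<integral>z. \<bar>f z - p z\<bar> \<partial>M) < e / 2"
      and q: "trig_poly q" "(\<integral>z. \<bar>g z - q z\<bar> \<partial>M) < e / 2"
      using add.IH add.prems by (meson half_gt_zero)
    note int = add.hyps integrable_trig_poly[OF fin M p(1)] integrable_trig_poly[OF fin M q(1)]
    have "(\<integral>z. \<bar>(f z + g z) - (p z + q z)\<bar> \<partial>M) \<le> (\<integral>z. \<bar>f z - p z\<bar> + \<bar>g z - q z\<bar> \<partial>M)"
      using int by (intro integral_mono) auto
    also have "\<dots> = (\<integral>z. \<bar>f z - p z\<bar> \<partial>M) + (\<integral>z. \<bar>g z - q z\<bar> \<partial>M)"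
      using int by (intro Bochner_Integration.integral_add) auto
    also have "\<dots> < e" using p q by simp
    finally show ?case using trig_poly.add[OF p(1) q(1)] by blast
  next
    case (lim f s)
    have "(\<lambda>i. \<integral>z. \<bar>f z - s i z\<bar> \<partial>M) \<longlonglongrightarrow> (\<integral>z. 0 \<partial>M)"
    \<comment> \<open>\<open>integrable_induct\<close> supplies \<open>s i\<close> bounded by twice
      \<open>\<bar>f\<bar>\<close>, hence the factor 3.\<close>
    proof (rule integral_dominated_convergence[where w = "\<lambda>z. 3 * \<bar>f z\<bar>"])
      show "AE z in M. (\<lambda>i. \<bar>f z - s i z\<bar>) \<longlonglongrightarrow> 0"
      proof (rule AE_I2)
        fix z assume "z \<in> space M"
        then have "(\<lambda>i. \<bar>f z - s i z\<bar>) \<longlonglongrightarrow> \<bar>f z - f z\<bar>" by (intro tendsto_intros lim)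
        then show "(\<lambda>i. \<bar>f z - s i z\<bar>) \<longlonglongrightarrow> 0" by simp
      qed
      show "AE z in M. norm \<bar>f z - s i z\<bar> \<le> 3 * \<bar>f z\<bar>" for i
        using lim(3)[of _ i] by (intro AE_I2) fastforce
    qed (use lim in auto)
    then have "\<forall>\<^sub>F i in sequentially. (\<integral>z. \<bar>f z - s i z\<bar> \<partial>M) < e / 2"
      using lim.prems by (intro order_tendstoD) auto
    then obtain i where i: "(\<integral>z. \<bar>f z - s i z\<bar> \<partial>M) < e / 2" by (auto simp: eventually_sequentially)
    obtain p where p: "trig_poly p" "(\<integral>z. \<bar>s i z - p z\<bar> \<partial>M) < e / 2"
      using lim.IH lim.prems by (meson half_gt_zero)
    note int = lim.hyps(1)[of i] lim.hyps(4) integrable_trig_poly[OF fin M p(1)]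
    have "(\<integral>z. \<bar>f z - p z\<bar> \<partial>M) \<le> (\<integral>z. \<bar>f z - s i z\<bar> + \<bar>s i z - p z\<bar> \<partial>M)"
      using int by (intro integral_mono) auto
    also have "\<dots> = (\<integral>z. \<bar>f z - s i z\<bar> \<partial>M) + (\<integral>z. \<bar>s i z - p z\<bar> \<partial>M)"
      using int by (intro Bochner_Integration.integral_add) auto
    also have "\<dots> < e" using p i by simp
    finally show ?case using p(1) by blast
  qed
qed

text \<open>Truncating at \<open>b\<close> cannot increase the distance to \<open>f\<close>, whose
  values already lie within \<open>b\<close>. The uniform bound on \<open>p\<close> is what
  dominated convergence will consume.\<close>

lemma trig_poly_approx_bounded:
  fixes M :: "'a::{real_inner, second_countable_topology, banach} measure"
  assumes fin: "finite_measure M" and M: "sets M = sets borel" and f: "f \<in> borel_measurable M" and b: "\<And>z. \<bar>f z\<bar> \<le> b"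
    and e: "e > 0"
  obtains p where "trig_poly p" "\<And>z. \<bar>p z\<bar> \<le> b + e" "(\<integral>z. \<bar>f z - p z\<bar> \<partial>M) < e"
proof -
  interpret finite_measure M by fact
  define d where "d = min e (e / (measure M (space M) + 2))"
  have den: "measure M (space M) + 2 > 0" by (simp add: add_nonneg_pos)
  then have d: "d > 0" "d \<le> e" using e by (auto simp: d_def)
  have fint: "integrable M f" using b f by (intro integrable_const_bound[of _ b]) auto
  obtain p where p: "trig_poly p" "(\<integral>z. \<bar>f z - p z\<bar> \<partial>M) < d"
    using trig_poly_approx_integrable[OF fin M fint d(1)] by blast
  obtain q where q: "trig_poly q" "\<And>z. \<bar>max (- b) (min b (p z)) - q z\<bar> < d"
    using trig_poly_approx_clamp[OF p(1) d(1)] by blast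
  have le: "\<bar>f z - q z\<bar> \<le> \<bar>f z - p z\<bar> + d" for z
    using q(2)[of z] b[of z] by linarith
  note int = fint integrable_trig_poly[OF fin M p(1)] integrable_trig_poly[OF fin M q(1)]
  have "(\<integral>z. \<bar>f z - q z\<bar> \<partial>M) \<le> (\<integral>z. \<bar>f z - p z\<bar> + d \<partial>M)"
    using int by (intro integral_mono le) auto
  also have "\<dots> = (\<integral>z. \<bar>f z - p z\<bar> \<partial>M) + d * measure M (space M)"
    using int by (subst Bochner_Integration.integral_add) auto
  also have "\<dots> < d * (measure M (space M) + 2)" using p d by (simp add: algebra_simps)
  also have "\<dots> \<le> e" using den by (simp add: d_def min_mult_distrib_right)
  finally have "(\<integral>z. \<bar>f z - q z\<bar> \<partial>M) < e" .
  moreover have "\<bar>q z\<bar> \<le> b + e" for z using q(2)[of z] b[of z] d by linarith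
  ultimately show ?thesis using that q(1) by blast
qed

section \<open>The covariance operator\<close>

text \<open>Pettis' theorem in a separable space: preimages of closed balls are countable
  intersections of conditions on the functionals in \<open>D\<close>, and open sets are countable
  unions of such balls. It turns weak measurability of the adjoint semigroup into the measurability
  demanded by the Bochner integral.\<close>

lemma weakly_measurable_imp_measurable:
  fixes F :: "'a \<Rightarrow> 'h::{real_inner, second_countable_topology}"
  assumes F: "\<And>y. (\<lambda>s. y \<bullet> F s) \<in> borel_measurable M"
  shows "F \<in> borel_measurable M"
proof -
  obtain D :: "'h set" where D: "countable D" "\<And>X. open X \<Longrightarrow> X \<noteq> {} \<Longrightarrow> \<exists>d\<in>D. d \<in> X"
    using countable_dense_exists by blast
  \<comment> \<open>The set of \<open>d\<close> violating the inequality is open, so it is empty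
    once it misses the dense \<open>D\<close>; then \<open>d = v\<close> may be inserted.\<close>
  have norm_le: "norm v \<le> r \<longleftrightarrow> (\<forall>d\<in>D. d \<bullet> v \<le> r * norm d)" if "0 \<le> r" for v r
  proof
    assume "norm v \<le> r"
    then show "\<forall>d\<in>D. d \<bullet> v \<le> r * norm d"
      by (metis mult.commute mult_left_mono norm_cauchy_schwarz norm_ge_zero order_trans)
  next
    assume le: "\<forall>d\<in>D. d \<bullet> v \<le> r * norm d"
    have "open {d. r * norm d < d \<bullet> v}" by (intro open_Collect_less continuous_intros)
    then have "{d. r * norm d < d \<bullet> v} = {}" using D(2) le by fastforce
    then have "v \<bullet> v \<le> r * norm v" by (auto simp: not_less)
    then show "norm v \<le> r"
      using \<open>0 \<le> r\<close> by (cases "v = 0") (auto simp: dot_square_norm power2_eq_square)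
  qed
  have cball: "F -` cball c r \<inter> space M \<in> sets M" for c r
  proof (cases "0 \<le> r")
    case True
    have "F -` cball c r \<inter> space M = {s \<in> space M. \<forall>d\<in>D. d \<bullet> F s - d \<bullet> c \<le> r * norm d}"
      using norm_le[OF True, of "F _ - c"]
      by (auto simp: mem_cball dist_norm norm_minus_commute[of c] inner_diff_right)
    also have "\<dots> \<in> sets M" using F D(1) by measurable
    finally show ?thesis .
  qed auto
  show ?thesis
  proof (rule borel_measurableI)
    fix U :: "'h set" assume "open U"
    define I where "I = {(d, r). d \<in> D \<and> r \<in> \<rat> \<and> cball d r \<subseteq> U}"
    have "countable I"
      by (rule countable_subset[of _ "D \<times> \<rat>"]) (auto simp: I_def D countable_rat)
    have "U = (\<Union>(d, r)\<in>I. cball d r)"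
    proof (intro equalityI subsetI)
      fix x assume "x \<in> U"
      then obtain e where e: "e > 0" "ball x e \<subseteq> U" using \<open>open U\<close> by (meson openE)
      obtain r where r: "r \<in> \<rat>" "0 < r" "r < e / 2"
        using Rats_dense_in_real[of 0 "e / 2"] e by auto
      obtain d where d: "d \<in> D" "d \<in> ball x r" using D(2)[of "ball x r"] r by auto
      have "cball d r \<subseteq> ball x e"
      proof
        fix y assume "y \<in> cball d r"
        then show "y \<in> ball x e" using dist_triangle[of x y d] d r by auto
      qed
      then have "(d, r) \<in> I" using d r e by (auto simp: I_def)
      moreover have "x \<in> cball d r" using d by (simp add: dist_commute)
      ultimately show "x \<in> (\<Union>(d, r)\<in>I. cball d r)" by blast
    qed (auto simp: I_def)
    then have "F -` U = (\<Union>i\<in>I. F -` cball (fst i) (snd i))"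
      by (metis (no_types, lifting) SUP_cong split_beta vimage_UN)
    then have "F -` U \<inter> space M = (\<Union>i\<in>I. F -` cball (fst i) (snd i) \<inter> space M)" by simp
    also have "\<dots> \<in> sets M" using \<open>countable I\<close> cball by (intro sets.countable_UN') auto
    finally show "F -` U \<inter> space M \<in> sets M" .
  qed
qed

text \<open>\<open>?r n s\<close> is the first multiple of \<open>1 / real (Suc n)\<close> strictly
  after \<open>s\<close>, so it tends to \<open>s\<close> from the right. It factors through the
  integer \<open>\<lfloor>real (Suc n) * s\<rfloor>\<close>, and on integers every function is
  measurable, whatever \<open>g\<close> is.\<close>

lemma right_continuous_imp_measurable:
  fixes g :: "real \<Rightarrow> real"
  assumes g: "\<And>s. s \<ge> 0 \<Longrightarrow> ((\<lambda>r. g (s + r)) \<longlongrightarrow> g s) (at_right 0)"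
  shows "(\<lambda>s. indicator {0..} s * g s) \<in> borel_measurable borel"
proof (rule borel_measurable_LIMSEQ_real)
  let ?r = "\<lambda>n s. (of_int \<lfloor>real (Suc n) * s\<rfloor> + 1) / real (Suc n)"
  show "(\<lambda>s. indicator {0..} s * g (?r n s)) \<in> borel_measurable borel" for n
    by (intro borel_measurable_times borel_measurable_indicator
        measurable_compose[of "\<lambda>s. \<lfloor>real (Suc n) * s\<rfloor>" _ "count_space UNIV" "\<lambda>i. g ((of_int i + 1) / real (Suc n))"])
      auto
  fix s :: real
  show "(\<lambda>n. indicator {0..} s * g (?r n s)) \<longlonglongrightarrow> indicator {0..} s * g s"
  proof (cases "s \<ge> 0")
    case True
    have pos: "0 < ?r n s - s \<and> ?r n s - s \<le> 1 / real (Suc n)" for n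
    proof -
      have "real_of_int \<lfloor>real (Suc n) * s\<rfloor> \<le> real (Suc n) * s"
        "real (Suc n) * s < real_of_int \<lfloor>real (Suc n) * s\<rfloor> + 1" by linarith+
      then show ?thesis by (simp add: field_simps del: of_nat_Suc)
    qed
    have "(\<lambda>n. ?r n s - s) \<longlonglongrightarrow> 0"
    proof (rule tendsto_sandwich[of "\<lambda>_. 0" _ _ "\<lambda>n. 1 / real (Suc n)"])
      show "(\<lambda>n. 1 / real (Suc n)) \<longlonglongrightarrow> 0" using LIMSEQ_Suc[OF lim_1_over_n] .
    qed (use pos in \<open>auto intro!: always_eventually less_imp_le simp del: of_nat_Suc\<close>)
    moreover have "?r n s - s \<in> {0<..}" "?r n s - s \<noteq> 0" for n using pos[of n] by auto
    ultimately have "filterlim (\<lambda>n. ?r n s - s) (at_right 0) sequentially"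
      unfolding filterlim_at by (auto intro!: always_eventually simp del: of_nat_Suc greaterThan_iff)
    from filterlim_compose[OF g[OF True] this] have "(\<lambda>n. g (?r n s)) \<longlonglongrightarrow> g s" by simp
    then show ?thesis by (intro tendsto_intros)
  qed simp
qed

section \<open>Growth of the semigroup and positivity of its covariance\<close>

lemma C0_semigroupD:
  assumes "C0_semigroup S"
  shows "s \<ge> 0 \<Longrightarrow> bounded_linear (S s)" "S 0 x = x"
    "r \<ge> 0 \<Longrightarrow> s \<ge> 0 \<Longrightarrow> S (r + s) x = S r (S s x)"
    "((\<lambda>t. S t x) \<longlongrightarrow> x) (at_right 0)"
  using assms by (auto simp: C0_semigroup_def)

text \<open>Otherwise there are times \<open>s n\<close> tending to 0 with operator norms that blow
  up, although strong continuity makes \<open>S (s n) y\<close> converge for each \<open>y\<close>;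
  uniform boundedness forbids this.\<close>

lemma C0_semigroup_bounded_near_0:
  fixes S :: "real \<Rightarrow> 'h \<Rightarrow> 'h::{real_inner, banach}"
  assumes S: "C0_semigroup S"
  shows "\<exists>d>0. \<exists>M\<ge>1. \<forall>s x. 0 \<le> s \<and> s \<le> d \<longrightarrow> norm (S s x) \<le> M * norm x"
proof -
  have "\<exists>n. \<forall>s x. 0 \<le> s \<and> s \<le> 1 / real (Suc n) \<longrightarrow> norm (S s x) \<le> real (Suc n) * norm x"
  proof (rule ccontr)
    assume "\<not> ?thesis"
    then have "\<forall>n. \<exists>s x. 0 \<le> s \<and> s \<le> 1 / real (Suc n) \<and> norm (S s x) > real (Suc n) * norm x"
      by (simp add: not_le)
    then obtain s x where sx: "\<And>n. 0 \<le> s n" "\<And>n. s n \<le> 1 / real (Suc n)"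
        "\<And>n. norm (S (s n) (x n)) > real (Suc n) * norm (x n)" by metis
    \<comment> \<open>The limit at 0 runs along \<open>at_right 0\<close>, so the times must be
      strictly positive; at time 0 the identity cannot violate the bound.\<close>
    have ne: "s n \<noteq> 0" for n
    proof
      assume "s n = 0"
      then have "norm (x n) > real (Suc n) * norm (x n)" using sx(3)[of n] C0_semigroupD(2)[OF S] by simp
      moreover have "1 * norm (x n) \<le> real (Suc n) * norm (x n)" by (intro mult_right_mono) auto
      ultimately show False by simp
    qed
    then have pos: "s n > 0" for n using sx(1)[of n] ne[of n] less_eq_real_def by metis
    have "s \<longlonglongrightarrow> 0"
      by (rule tendsto_sandwich[of "\<lambda>_. 0" _ _ "\<lambda>n. 1 / real (Suc n)"])
        (use sx in \<open>auto intro!: always_eventually LIMSEQ_Suc[OF lim_1_over_n] simp del: of_nat_Suc\<close>)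
    then have "filterlim s (at_right 0) sequentially"
      unfolding filterlim_at by (auto intro!: always_eventually simp: pos ne)
    then have lim: "(\<lambda>n. S (s n) y) \<longlonglongrightarrow> y" for y
      by (rule filterlim_compose[OF C0_semigroupD(4)[OF S]])
    have "\<exists>B. \<forall>T\<in>range (\<lambda>n. S (s n)). norm (T y) \<le> B" for y
      using Bseq_eq_bounded[of "\<lambda>n. S (s n) y"] convergent_imp_Bseq[OF convergentI[OF lim[of y]]]
      by (auto simp: bounded_iff)
    moreover have "bounded_linear T" if "T \<in> range (\<lambda>n. S (s n))" for T
      using that C0_semigroupD(1)[OF S sx(1)] by auto
    ultimately obtain M where "\<And>T y. T \<in> range (\<lambda>n. S (s n)) \<Longrightarrow> norm (T y) \<le> M * norm y"
      using uniform_boundedness_principle[of "range (\<lambda>n. S (s n))"] by metis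
    then have M: "norm (S (s n) y) \<le> M * norm y" for n y by blast
    obtain n where n: "M \<le> real n" using real_arch_simple by blast
    have "norm (S (s n) (x n)) \<le> real (Suc n) * norm (x n)"
      using n by (intro order_trans[OF M] mult_right_mono) auto
    then show False using sx(3)[of n] by simp
  qed
  then obtain n where n: "\<And>s x. 0 \<le> s \<Longrightarrow> s \<le> 1 / real (Suc n) \<Longrightarrow> norm (S s x) \<le> real (Suc n) * norm x"
    by blast
  have "0 < 1 / real (Suc n) \<and> (\<exists>M\<ge>1. \<forall>s x. 0 \<le> s \<and> s \<le> 1 / real (Suc n) \<longrightarrow> norm (S s x) \<le> M * norm x)"
    using n by (intro conjI exI[of _ "real (Suc n)"]) auto
  then show ?thesis by blast
qed

text \<open>The semigroup law cuts \<open>s\<close> into at most \<open>k\<close> pieces of length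
  at most \<open>d\<close>, each costing a factor \<open>M\<close>.\<close>

lemma C0_semigroup_locally_bounded:
  fixes S :: "real \<Rightarrow> 'h \<Rightarrow> 'h::{real_inner, banach}"
  assumes S: "C0_semigroup S"
  shows "\<exists>M\<ge>0. \<forall>s x. 0 \<le> s \<and> s \<le> t \<longrightarrow> norm (S s x) \<le> M * norm x"
proof -
  obtain d M where d: "d > 0" and M: "M \<ge> 1"
    and near: "\<And>s x. 0 \<le> s \<Longrightarrow> s \<le> d \<Longrightarrow> norm (S s x) \<le> M * norm x"
    using C0_semigroup_bounded_near_0[OF S] by blast
  have bound: "norm (S s x) \<le> M ^ k * norm x" if "0 \<le> s" "s \<le> real k * d" for k s x
    using that
  proof (induction k arbitrary: s x)
    case 0
    then show ?case using C0_semigroupD(2)[OF S] by simp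
  next
    case (Suc k)
    define r where "r = min s d"
    have r: "0 \<le> r" "r \<le> d" "0 \<le> s - r" "s - r \<le> real k * d"
      using Suc.prems d by (auto simp: r_def min_def algebra_simps)
    have "S s x = S r (S (s - r) x)" using C0_semigroupD(3)[OF S r(1,3), of x] by simp
    also have "norm \<dots> \<le> M * norm (S (s - r) x)" using near[OF r(1,2)] .
    also have "\<dots> \<le> M * (M ^ k * norm x)" using Suc.IH[OF r(3,4)] M by (intro mult_left_mono) auto
    finally show ?case by (simp add: mult.assoc)
  qed
  obtain k where "t / d \<le> real k" using real_arch_simple by blast
  then have k: "t \<le> real k * d" using d by (simp add: field_simps)
  show ?thesis
  proof (intro exI[of _ "M ^ k"] conjI allI impI)
    show "0 \<le> M ^ k" using M by simp
    show "norm (S s x) \<le> M ^ k * norm x" if "0 \<le> s \<and> s \<le> t" for s x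
      using that k by (intro bound) auto
  qed
qed

text \<open>With \<open>f x s\<close> the image of \<open>x\<close> under the adjoint of
  \<open>S s \<circ> G\<close>, the form \<open>y \<bullet> Q x\<close> is the integral of
  \<open>f y s \<bullet> f x s\<close> over \<open>{0..t}\<close>, which is visibly symmetric and
  nonnegative. The work is integrability, without which the inner product cannot be moved under the
  integral.\<close>

lemma Q_op_positive:
  fixes S :: "real \<Rightarrow> 'h \<Rightarrow> 'h::{real_inner, banach, second_countable_topology}"
    and G :: "'x::{real_inner, banach, second_countable_topology} \<Rightarrow> 'h"
  assumes S: "C0_semigroup S" and G: "bounded_linear G" and Q: "bounded_linear (Q_op S G t)"
  shows "positive_operator (Q_op S G t)"
proof -
  interpret G: bounded_linear G by fact
  define f where "f x s = adjoint G (adjoint (S s) x)" for x s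
  have f: "e \<bullet> f x s = S s (G e) \<bullet> x" if "s \<ge> 0" for e x s
    using adjoint_inner[OF G] adjoint_inner[OF C0_semigroupD(1)[OF S that]] by (simp add: f_def)
  obtain M where M: "M \<ge> 0" "\<And>s x. 0 \<le> s \<Longrightarrow> s \<le> t \<Longrightarrow> norm (S s x) \<le> M * norm x"
    using C0_semigroup_locally_bounded[OF S, of t] by blast
  obtain g where g: "g > 0" "\<And>x. norm (G x) \<le> g * norm x"
    using G.pos_bounded by (auto simp: mult.commute)
  have SG: "norm (S s (G e)) \<le> M * g * norm e" if "0 \<le> s" "s \<le> t" for s e
  proof -
    have "norm (S s (G e)) \<le> M * norm (G e)" using M(2)[OF that] .
    also have "\<dots> \<le> M * (g * norm e)" using g M(1) by (intro mult_left_mono) auto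
    finally show ?thesis by (simp add: mult.assoc)
  qed
  \<comment> \<open>An adjoint has the same bound as the operator: test the duality \<open>f\<close>
    with \<open>e = f x s\<close> itself and cancel one factor.\<close>
  have f_bound: "norm (f x s) \<le> M * g * norm x" if s: "0 \<le> s" "s \<le> t" for x s
  proof (cases "f x s = 0")
    case False
    have "norm (f x s) * norm (f x s) = S s (G (f x s)) \<bullet> x"
      using f[OF s(1), of "f x s" x] by (simp add: dot_square_norm power2_eq_square)
    also have "\<dots> \<le> norm (S s (G (f x s))) * norm x" by (rule norm_cauchy_schwarz)
    also have "\<dots> \<le> (M * g * norm (f x s)) * norm x" using SG[OF s] by (intro mult_right_mono) auto
    finally have "norm (f x s) * norm (f x s) \<le> (M * g * norm x) * norm (f x s)" by (simp add: algebra_simps)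
    then show ?thesis using False by simp
  qed (use M g in simp)
  \<comment> \<open>Tested against \<open>e\<close>, the adjoints disappear:
    \<open>S s (G e) \<bullet> x\<close> is right continuous in \<open>s\<close> by the semigroup
    law and continuity at 0.\<close>
  have f_meas: "(\<lambda>s. indicator {0..t} s *\<^sub>R f x s) \<in> borel_measurable borel" for x
  proof (rule weakly_measurable_imp_measurable)
    fix e
    have "(\<lambda>s. indicator {0..} s * (S s (G e) \<bullet> x)) \<in> borel_measurable borel"
    proof (rule right_continuous_imp_measurable)
      fix s :: real assume s: "s \<ge> 0"
      have "((\<lambda>r. S r (S s (G e)) \<bullet> x) \<longlongrightarrow> S s (G e) \<bullet> x) (at_right 0)"
        by (intro tendsto_intros C0_semigroupD(4)[OF S])
      moreover have "\<forall>\<^sub>F r in at_right 0. S r (S s (G e)) \<bullet> x = S (s + r) (G e) \<bullet> x"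
        using eventually_at_right_less[of 0]
        by eventually_elim (use C0_semigroupD(3)[OF S _ s] in \<open>simp add: add.commute\<close>)
      ultimately show "((\<lambda>r. S (s + r) (G e) \<bullet> x) \<longlongrightarrow> S s (G e) \<bullet> x) (at_right 0)"
        by (rule Lim_transform_eventually)
    qed
    then have "(\<lambda>s. indicator {0..t} s * (indicator {0..} s * (S s (G e) \<bullet> x))) \<in> borel_measurable borel"
      by measurable
    also have "(\<lambda>s. indicator {0..t} s * (indicator {0..} s * (S s (G e) \<bullet> x))) =
        (\<lambda>s. e \<bullet> (indicator {0..t} s *\<^sub>R f x s))"
      by (auto simp: f indicator_def fun_eq_iff)
    finally show "(\<lambda>s. e \<bullet> (indicator {0..t} s *\<^sub>R f x s)) \<in> borel_measurable borel" .
  qed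
  define F where "F x s = indicator {0..t} s *\<^sub>R S s (G (f x s))" for x s
  have F: "y \<bullet> F x s = (indicator {0..t} s *\<^sub>R f y s) \<bullet> (indicator {0..t} s *\<^sub>R f x s)" for x y s
    using f[of s "f x s" y] by (auto simp: F_def indicator_def inner_commute)
  have F_int: "integrable lborel (F x)" for x
  proof (rule Bochner_Integration.integrable_bound)
    show "integrable lborel (\<lambda>s. indicator {0..t} s * (M * g * (M * g * norm x)))"
      by (intro integrable_mult_left integrable_real_indicator) (auto simp: emeasure_lborel_Icc_eq)
    show "F x \<in> borel_measurable lborel"
      by (rule weakly_measurable_imp_measurable)
        (use f_meas in \<open>simp add: F borel_measurable_inner del: inner_scaleR_left inner_scaleR_right\<close>)
    have "norm (S s (G (f x s))) \<le> M * g * (M * g * norm x)" if s: "0 \<le> s" "s \<le> t" for s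
    proof -
      have "norm (S s (G (f x s))) \<le> M * g * norm (f x s)" using SG[OF s] .
      also have "\<dots> \<le> M * g * (M * g * norm x)" using f_bound[OF s] M g by (intro mult_left_mono) auto
      finally show ?thesis .
    qed
    then show "AE s in lborel. norm (F x s) \<le> norm (indicator {0..t} s * (M * g * (M * g * norm x)))"
      using M g by (intro AE_I2) (auto simp: F_def indicator_def abs_mult)
  qed
  have Q_inner: "y \<bullet> Q_op S G t x =
      (\<integral>s. (indicator {0..t} s *\<^sub>R f y s) \<bullet> (indicator {0..t} s *\<^sub>R f x s) \<partial>lborel)" for x y
  proof -
    have "Q_op S G t x = (\<integral>s. F x s \<partial>lborel)"
      by (simp add: Q_op_def set_lebesgue_integral_def F_def f_def)
    then have "y \<bullet> Q_op S G t x = (\<integral>s. y \<bullet> F x s \<partial>lborel)" using F_int[of x] by simp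
    then show ?thesis by (simp only: F)
  qed
  show ?thesis
    unfolding positive_operator_def
  proof (intro conjI allI Q)
    show "Q_op S G t x \<bullet> y = x \<bullet> Q_op S G t y" for x y
      unfolding inner_commute[of _ y] Q_inner by (simp only: inner_commute)
    show "0 \<le> Q_op S G t x \<bullet> x" for x
      unfolding inner_commute[of _ x] Q_inner by (intro Bochner_Integration.integral_nonneg) simp
  qed
qed

section \<open>The pseudoinverse\<close>

text \<open>The preimages of \<open>y\<close> form a closed convex nonempty set, so
  \<open>ARG_MIN\<close> is attained. Minimality along the lines in kernel directions gives the
  orthogonality.\<close>

lemma pseudoinverse_works:
  fixes R :: "'h::{real_inner, banach} \<Rightarrow> 'h"
  assumes R: "bounded_linear R" and y: "y \<in> range R"
  shows "R (pseudoinverse R y) = y" "R m = 0 \<Longrightarrow> pseudoinverse R y \<bullet> m = 0"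
proof -
  interpret R: bounded_linear R by fact
  have "closed {h. R h = y}" by (intro closed_Collect_eq continuous_intros R.continuous_on)
  moreover have "convex {h. R h = y}"
  proof (rule convexI)
    fix a b and u v :: real assume "a \<in> {h. R h = y}" "b \<in> {h. R h = y}" and uv: "u + v = 1"
    then have "R (u *\<^sub>R a + v *\<^sub>R b) = (u + v) *\<^sub>R y" by (simp add: R.add R.scaleR flip: scaleR_add_left)
    then show "u *\<^sub>R a + v *\<^sub>R b \<in> {h. R h = y}" using uv by simp
  qed
  moreover have "{h. R h = y} \<noteq> {}" using y by auto
  ultimately obtain h where "h \<in> {h. R h = y}" "\<And>x. x \<in> {h. R h = y} \<Longrightarrow> norm h \<le> norm x"
    by (rule closed_convex_min_norm) blast
  then have "is_arg_min norm (\<lambda>h. R h = y) h" by (auto simp: is_arg_min_def not_less)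
  then have "is_arg_min norm (\<lambda>h. R h = y) (pseudoinverse R y)"
    unfolding pseudoinverse_def arg_min_def by (rule someI)
  then have R_pinv: "R (pseudoinverse R y) = y"
    and min: "\<And>h. R h = y \<Longrightarrow> norm (pseudoinverse R y) \<le> norm h"
    by (auto simp: is_arg_min_def not_less)
  show "R (pseudoinverse R y) = y" by (rule R_pinv)
  show "pseudoinverse R y \<bullet> m = 0" if "R m = 0"
    by (rule min_norm_orthogonal, rule min) (simp add: R.add R.scaleR R_pinv that)
qed

text \<open>Two preimages orthogonal to the kernel differ by a kernel element orthogonal to itself.
  Both conditions are linear in \<open>h\<close>, and this is where linearity of the pseudoinverse
  comes from.\<close>

lemma pseudoinverse_eqI:
  fixes R :: "'h::{real_inner, banach} \<Rightarrow> 'h"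
  assumes R: "bounded_linear R" and h: "R h = y" "\<And>m. R m = 0 \<Longrightarrow> h \<bullet> m = 0"
  shows "pseudoinverse R y = h"
proof -
  interpret R: bounded_linear R by fact
  have y: "y \<in> range R" using h(1) by blast
  let ?d = "pseudoinverse R y - h"
  have "R ?d = 0" using pseudoinverse_works(1)[OF R y] h(1) by (simp add: R.diff)
  then have "?d \<bullet> ?d = 0"
    using pseudoinverse_works(2)[OF R y] h(2) by (simp add: inner_diff_left[of _ _ "_ - _"])
  then show ?thesis by simp
qed

text \<open>Closed graph theorem for \<open>R\<^sup>-\<^sup>1 B\<close>: the functionals \<open>\<lambda>k. v \<bullet> B k = R v \<bullet> R\<^sup>-\<^sup>1 (B k)\<close> with
  \<open>norm (R v) \<le> 1\<close> are pointwise bounded.\<close>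

lemma bounded_linear_pseudoinverse_comp:
  fixes R :: "'h::{real_inner, banach} \<Rightarrow> 'h" and B :: "'k::banach \<Rightarrow> 'h"
  assumes R: "bounded_linear R" and sym: "\<And>x y. R x \<bullet> y = x \<bullet> R y"
    and B: "bounded_linear B" and range: "range B \<subseteq> range R"
  shows "bounded_linear (\<lambda>k. pseudoinverse R (B k))"
proof -
  interpret R: bounded_linear R by fact
  interpret B: bounded_linear B by fact
  define T where "T k = pseudoinverse R (B k)" for k
  have "B k \<in> range R" for k using range by auto
  then have T: "R (T k) = B k" "R m = 0 \<Longrightarrow> T k \<bullet> m = 0" for k m
    using pseudoinverse_works[OF R] by (auto simp: T_def)
  let ?F = "(\<lambda>v k. v \<bullet> B k) ` {v. norm (R v) \<le> 1}"
  have Rv: "v \<bullet> B k = R v \<bullet> T k" for v k by (simp add: sym T)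
  have "\<exists>b. \<forall>f\<in>?F. norm (f k) \<le> b" for k
  proof (intro exI[of _ "norm (T k)"] ballI)
    fix f assume "f \<in> ?F"
    then obtain v where v: "f = (\<lambda>k. v \<bullet> B k)" "norm (R v) \<le> 1" by auto
    have "\<bar>R v \<bullet> T k\<bar> \<le> norm (R v) * norm (T k)" by (rule Cauchy_Schwarz_ineq2)
    also have "\<dots> \<le> norm (T k)" using v(2) by (simp add: mult_left_le_one_le)
    finally show "norm (f k) \<le> norm (T k)" by (simp add: v(1) Rv)
  qed
  moreover have "bounded_linear f" if "f \<in> ?F" for f
    using that by (auto intro!: bounded_linear_inner_right_comp B.bounded_linear)
  ultimately obtain M where M: "M \<ge> 0" "\<And>f k. f \<in> ?F \<Longrightarrow> norm (f k) \<le> M * norm k"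
    using uniform_boundedness_principle[of ?F] by metis
  have le: "R v \<bullet> T k \<le> norm (R v) * (M * norm k)" for v k
  proof (cases "R v = 0")
    case False
    define u where "u = v /\<^sub>R norm (R v)"
    have "norm (R u) \<le> 1" using False by (simp add: u_def R.scaleR)
    then have "\<bar>u \<bullet> B k\<bar> \<le> M * norm k" using M(2)[of "\<lambda>k. u \<bullet> B k"] by auto
    then have "R u \<bullet> T k \<le> M * norm k" by (simp add: Rv)
    then show ?thesis using False by (simp add: u_def R.scaleR field_simps)
  qed simp
  have bound: "norm (T k) \<le> norm k * M" for k
  proof -
    \<comment> \<open>The bound \<open>le\<close> only allows tests with range points; since
      \<open>T k\<close> is a limit of such points, it can be tested with itself.\<close>
    have "T k \<in> closure (range R)" by (rule closure_range_symmetric[OF R sym]) (use T in auto)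
    then obtain g where g: "\<And>n. g n \<in> range R" "g \<longlonglongrightarrow> T k" unfolding closure_sequential by metis
    have "g n \<bullet> T k \<le> norm (g n) * (M * norm k)" for n using le g(1)[of n] by auto
    moreover have "(\<lambda>n. g n \<bullet> T k) \<longlonglongrightarrow> T k \<bullet> T k" "(\<lambda>n. norm (g n) * (M * norm k)) \<longlonglongrightarrow> norm (T k) * (M * norm k)"
      by (intro tendsto_intros g)+
    ultimately have "T k \<bullet> T k \<le> norm (T k) * (M * norm k)" by (meson LIMSEQ_le)
    then show ?thesis
      using M(1) by (cases "T k = 0") (auto simp: dot_square_norm power2_eq_square mult.commute)
  qed
  have "bounded_linear T"
  proof (rule bounded_linear_intro[OF _ _ bound])
    show "T (x + y) = T x + T y" for x y
      unfolding T_def[of "x + y"]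
      by (rule pseudoinverse_eqI[OF R]) (simp_all add: R.add B.add T inner_add_left)
    show "T (r *\<^sub>R x) = r *\<^sub>R T x" for r x
      unfolding T_def[of "r *\<^sub>R x"]
      by (rule pseudoinverse_eqI[OF R]) (simp_all add: R.scaleR B.scaleR T)
  qed
  then show ?thesis by (simp add: T_def[abs_def])
qed

section \<open>Gaussian integration by parts\<close>

text \<open>\<open>\<theta>\<close> is 1-Lipschitz, so the difference quotients are dominated by
  \<open>\<bar>Y z * W z\<bar>\<close>. The weight \<open>W\<close> allows a second use:
  \<open>W = 1\<close> gives the first Stein identity and \<open>W z = v \<bullet> z\<close> the
  second.\<close>

lemma has_derivative_under_integral:
  fixes X Y W :: "'a \<Rightarrow> real"
  assumes X: "X \<in> borel_measurable M" and Y: "Y \<in> borel_measurable M" and W: "integrable M W"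
    and YW: "integrable M (\<lambda>z. Y z * W z)"
    and \<theta>: "\<And>x. (\<theta> has_real_derivative \<theta>' x) (at x)" "\<And>x. \<bar>\<theta> x\<bar> \<le> 1" "\<And>x. \<bar>\<theta>' x\<bar> \<le> 1"
    and meas: "\<theta> \<in> borel_measurable borel" "\<theta>' \<in> borel_measurable borel"
  shows "((\<lambda>r. \<integral>z. \<theta> (X z + r * Y z) * W z \<partial>M) has_real_derivative (\<integral>z. \<theta>' (X z) * (Y z * W z) \<partial>M)) (at 0)"
  unfolding DERIV_def tendsto_at_iff_sequentially comp_def
proof (intro allI impI)
  fix h :: "nat \<Rightarrow> real" assume h: "\<forall>i. h i \<in> UNIV - {0}" "h \<longlonglongrightarrow> 0"
  note [measurable] = X Y meas borel_measurable_integrable[OF W]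
  have int: "integrable M (\<lambda>z. \<theta> (X z + r * Y z) * W z)" for r
    by (rule Bochner_Integration.integrable_bound[OF W])
      (auto simp: abs_mult intro!: mult_left_le_one_le \<theta>)
  have "(\<lambda>i. \<integral>z. (\<theta> (X z + h i * Y z) - \<theta> (X z)) / h i * W z \<partial>M) \<longlonglongrightarrow> (\<integral>z. \<theta>' (X z) * (Y z * W z) \<partial>M)"
  proof (rule integral_dominated_convergence[where w = "\<lambda>z. \<bar>Y z * W z\<bar>"])
    show "AE z in M. (\<lambda>i. (\<theta> (X z + h i * Y z) - \<theta> (X z)) / h i * W z) \<longlonglongrightarrow> \<theta>' (X z) * (Y z * W z)"
    proof (rule AE_I2)
      fix z
      have "((\<lambda>r. \<theta> (X z + r * Y z)) has_real_derivative \<theta>' (X z) * Y z) (at 0)"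
      proof -
        have "((\<lambda>r. X z + r * Y z) has_real_derivative Y z) (at 0)"
          by (auto intro!: derivative_eq_intros)
        from DERIV_chain2[OF _ this, of \<theta> "\<theta>' (X z)"] \<theta>(1)[of "X z"] show ?thesis by simp
      qed
      then have "(\<lambda>i. (\<theta> (X z + h i * Y z) - \<theta> (X z)) / h i) \<longlonglongrightarrow> \<theta>' (X z) * Y z"
        using h unfolding DERIV_def tendsto_at_iff_sequentially comp_def by auto
      from tendsto_mult_right[OF this, of "W z"]
      show "(\<lambda>i. (\<theta> (X z + h i * Y z) - \<theta> (X z)) / h i * W z) \<longlonglongrightarrow> \<theta>' (X z) * (Y z * W z)"
        by (simp add: mult.assoc)
    qed
    have lip: "\<bar>\<theta> x - \<theta> y\<bar> \<le> \<bar>x - y\<bar>" for x y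
      using field_differentiable_bound[of UNIV \<theta> \<theta>' 1 x y] \<theta> by auto
    show "AE z in M. norm ((\<theta> (X z + h i * Y z) - \<theta> (X z)) / h i * W z) \<le> \<bar>Y z * W z\<bar>" for i
    proof (rule AE_I2)
      fix z
      have hi: "h i \<noteq> 0" using h by auto
      have "\<bar>\<theta> (X z + h i * Y z) - \<theta> (X z)\<bar> \<le> \<bar>h i\<bar> * \<bar>Y z\<bar>"
        using lip[of "X z + h i * Y z" "X z"] by (simp add: abs_mult)
      then have "\<bar>(\<theta> (X z + h i * Y z) - \<theta> (X z)) / h i\<bar> \<le> \<bar>Y z\<bar>"
        using hi by (simp add: abs_divide field_simps)
      then show "norm ((\<theta> (X z + h i * Y z) - \<theta> (X z)) / h i * W z) \<le> \<bar>Y z * W z\<bar>"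
        by (simp only: abs_mult real_norm_def) (intro mult_right_mono, auto)
    qed
  qed (use YW in auto)
  also have "(\<lambda>i. \<integral>z. (\<theta> (X z + h i * Y z) - \<theta> (X z)) / h i * W z \<partial>M) =
      (\<lambda>i. ((\<integral>z. \<theta> (X z + (0 + h i) * Y z) * W z \<partial>M) - (\<integral>z. \<theta> (X z + 0 * Y z) * W z \<partial>M)) / h i)"
  proof
    fix i
    have "(\<integral>z. (\<theta> (X z + h i * Y z) - \<theta> (X z)) / h i * W z \<partial>M) =
        (\<integral>z. (\<theta> (X z + h i * Y z) * W z - \<theta> (X z) * W z) / h i \<partial>M)"
      by (simp add: left_diff_distrib)
    then show "(\<integral>z. (\<theta> (X z + h i * Y z) - \<theta> (X z)) / h i * W z \<partial>M) =
        ((\<integral>z. \<theta> (X z + (0 + h i) * Y z) * W z \<partial>M) - (\<integral>z. \<theta> (X z + 0 * Y z) * W z \<partial>M)) / h i"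
      using int[of "h i"] int[of 0] by simp
  qed
  finally show "(\<lambda>i. ((\<integral>z. \<theta> (X z + (0 + h i) * Y z) * W z \<partial>M) - (\<integral>z. \<theta> (X z + 0 * Y z) * W z \<partial>M)) /
      (h i)) \<longlonglongrightarrow> (\<integral>z. \<theta>' (X z) * (Y z * W z) \<partial>M)" .
qed

text \<open>Real part of the characteristic function after rotation by the phase
  \<open>b\<close>.\<close>

lemma std_normal_cos:
  "(\<integral>x. cos (b + s * x) \<partial>std_normal_distribution) = cos b * exp (- s\<^sup>2 / 2)"
proof -
  interpret real_distribution std_normal_distribution by (rule real_dist_normal_dist)
  have int: "integrable std_normal_distribution (\<lambda>x. cis b * iexp (s * x))"
    by (intro integrable_mult_right) (rule integrable_iexp, auto)
  have "(\<integral>x. cos (b + s * x) \<partial>std_normal_distribution) = (\<integral>x. Re (cis b * iexp (s * x)) \<partial>std_normal_distribution)"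
    by (simp only: of_real_mult[symmetric] cis_conv_exp[symmetric] cis_mult cis.simps)
  also have "\<dots> = Re (\<integral>x. cis b * iexp (s * x) \<partial>std_normal_distribution)"
    by (rule integral_Re[OF int])
  also have "(\<integral>x. cis b * iexp (s * x) \<partial>std_normal_distribution) = cis b * char std_normal_distribution s"
    by (simp add: char_def)
  also have "Re \<dots> = cos b * exp (- s\<^sup>2 / 2)" by (simp add: char_std_normal_distribution)
  finally show ?thesis .
qed

section \<open>Single functionals under a centered Gaussian measure\<close>

locale centered_gaussian = prob_space \<mu>
  for Q :: "'h \<Rightarrow> 'h::{real_inner, banach, second_countable_topology}" and \<mu> :: "'h measure" +
  assumes pos: "positive_operator Q" and gauss: "gaussian_measure 0 Q \<mu>"
begin

sublocale Q: bounded_linear Q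
  using positive_operatorD(1)[OF pos] .

lemma Q_sym: "Q x \<bullet> y = x \<bullet> Q y"
  by (rule positive_operatorD(2)[OF pos])

lemma Q_nonneg: "0 \<le> x \<bullet> Q x"
  using positive_operatorD(3)[OF pos, of x] by (simp only: inner_commute)

lemma sets_mu [measurable_cong]: "sets \<mu> = sets borel"
  using gauss by (simp add: gaussian_measure_def)

lemma space_mu [simp]: "space \<mu> = UNIV"
  using sets_eq_imp_space_eq[OF sets_mu] by simp

lemma distr_inner: "distr \<mu> borel (\<lambda>z. u \<bullet> z) = normal_law 0 (u \<bullet> Q u)"
  using gauss by (simp add: gaussian_measure_def)

lemma variance_zero_AE:
  assumes "u \<bullet> Q u = 0"
  shows "AE z in \<mu>. u \<bullet> z = 0"
proof -
  have "AE x in distr \<mu> borel (\<lambda>z. u \<bullet> z). x = 0"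
    unfolding distr_inner assms normal_law_def by (simp add: AE_return)
  then show ?thesis by (subst (asm) AE_distr_iff) auto
qed

lemma distributed_inner:
  assumes "0 < u \<bullet> Q u"
  shows "distributed \<mu> lborel (\<lambda>z. u \<bullet> z) (normal_density 0 (sqrt (u \<bullet> Q u)))"
proof -
  have "distr \<mu> lborel (\<lambda>z. u \<bullet> z) = distr \<mu> borel (\<lambda>z. u \<bullet> z)" by (rule distr_cong) auto
  then show ?thesis using assms distr_inner[of u] by (auto simp: distributed_def normal_law_def)
qed

lemma integral_cos_inner: "(\<integral>z. cos (b + u \<bullet> z) \<partial>\<mu>) = cos b * exp (- (u \<bullet> Q u) / 2)"
\<comment> \<open>For variance 0 the law is a point mass and has no density, so it cannot be
  standardized.\<close>
proof (cases "u \<bullet> Q u = 0")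
  case True
  have "(\<integral>z. cos (b + u \<bullet> z) \<partial>\<mu>) = (\<integral>z. cos b \<partial>\<mu>)"
    using variance_zero_AE[OF True] by (intro integral_cong_AE) auto
  then show ?thesis using True by (simp add: prob_space[simplified])
next
  case False
  define s where "s = sqrt (u \<bullet> Q u)"
  have s: "0 < s" "s\<^sup>2 = u \<bullet> Q u" using False Q_nonneg[of u] by (simp_all add: s_def)
  have "distributed \<mu> lborel (\<lambda>z. (u \<bullet> z - 0) / s) std_normal_density"
    using distributed_inner[of u] normal_standard_normal_convert[OF s(1), of "\<lambda>z. u \<bullet> z" 0] False Q_nonneg[of u]
    by (simp add: s_def)
  then have "(\<integral>x. std_normal_density x * cos (b + s * x) \<partial>lborel) = (\<integral>z. cos (b + s * ((u \<bullet> z - 0) / s)) \<partial>\<mu>)"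
    by (rule distributed_integral) auto
  moreover have "(\<integral>x. std_normal_density x * cos (b + s * x) \<partial>lborel) = (\<integral>x. cos (b + s * x) \<partial>std_normal_distribution)"
    by (subst integral_density) auto
  ultimately show ?thesis using s by (simp add: std_normal_cos)
qed

lemma integrable_inner_sq: "integrable \<mu> (\<lambda>z. (u \<bullet> z)\<^sup>2)"
  and integral_inner_sq: "(\<integral>z. (u \<bullet> z)\<^sup>2 \<partial>\<mu>) = u \<bullet> Q u"
proof -
  have "integrable \<mu> (\<lambda>z. (u \<bullet> z)\<^sup>2) \<and> (\<integral>z. (u \<bullet> z)\<^sup>2 \<partial>\<mu>) = u \<bullet> Q u"
  proof (cases "u \<bullet> Q u = 0")
    case True
    have "AE z in \<mu>. (u \<bullet> z)\<^sup>2 = 0" using variance_zero_AE[OF True] by auto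
    then show ?thesis
      using True by (simp add: integrable_cong_AE[of _ \<mu> "\<lambda>_. 0"] integral_cong_AE[of _ \<mu> "\<lambda>_. 0"])
  next
    case False
    define s where "s = sqrt (u \<bullet> Q u)"
    have s: "0 < s" "s\<^sup>2 = u \<bullet> Q u" using False Q_nonneg[of u] by (simp_all add: s_def)
    have dist: "distributed \<mu> lborel (\<lambda>z. u \<bullet> z) (normal_density 0 s)"
      using distributed_inner[of u] False Q_nonneg[of u] by (simp add: s_def)
    have "has_bochner_integral lborel (\<lambda>x. normal_density 0 s x * x\<^sup>2) (s\<^sup>2)"
      using normal_moment_even[OF s(1), of 0 1] by (simp add: fact_numeral)
    then have "integrable lborel (\<lambda>x. normal_density 0 s x * x\<^sup>2)"
        "(\<integral>x. normal_density 0 s x * x\<^sup>2 \<partial>lborel) = s\<^sup>2"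
      by (auto simp: has_bochner_integral_iff)
    then show ?thesis
      using distributed_integrable[OF dist, of "\<lambda>x. x\<^sup>2"] distributed_integral[OF dist, of "\<lambda>x. x\<^sup>2"] s(2)
      by simp
  qed
  then show "integrable \<mu> (\<lambda>z. (u \<bullet> z)\<^sup>2)" "(\<integral>z. (u \<bullet> z)\<^sup>2 \<partial>\<mu>) = u \<bullet> Q u" by auto
qed

lemma integrable_inner: "integrable \<mu> (\<lambda>z. u \<bullet> z)"
  by (rule square_integrable_imp_integrable[OF _ integrable_inner_sq]) auto

lemma exponent_derivative:
  "((\<lambda>r. exp (- ((u + r *\<^sub>R v) \<bullet> Q (u + r *\<^sub>R v)) / 2)) has_real_derivative
    - (u \<bullet> Q v) * exp (- (u \<bullet> Q u) / 2)) (at 0)"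
proof -
  have "(u + r *\<^sub>R v) \<bullet> Q (u + r *\<^sub>R v) = u \<bullet> Q u + 2 * r * (u \<bullet> Q v) + r\<^sup>2 * (v \<bullet> Q v)" for r
    using Q_sym[of v u]
    by (simp add: Q.add Q.scaleR inner_add_left inner_add_right inner_commute power2_eq_square algebra_simps)
  then show ?thesis by (auto intro!: derivative_eq_intros)
qed

text \<open>Differentiate the closed form of the integral of
  \<open>cos (b + (u + r *\<^sub>R v) \<bullet> z)\<close> at \<open>r = 0\<close> in two ways. The
  mixed moment of \<open>u \<bullet> z\<close> and \<open>v \<bullet> z\<close> is thus found
  without their joint law.\<close>

lemma stein_sin:
  "(\<integral>z. sin (b + u \<bullet> z) * (v \<bullet> z) \<partial>\<mu>) = (u \<bullet> Q v) * (cos b * exp (- (u \<bullet> Q u) / 2))"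
proof -
  have "((\<lambda>r. \<integral>z. cos ((b + u \<bullet> z) + r * (v \<bullet> z)) * 1 \<partial>\<mu>) has_real_derivative
      (\<integral>z. - sin (b + u \<bullet> z) * ((v \<bullet> z) * 1) \<partial>\<mu>)) (at 0)"
    by (rule has_derivative_under_integral)
      (auto intro!: integrable_inner derivative_eq_intros borel_measurable_continuous_onI continuous_intros)
  moreover have "(\<integral>z. cos ((b + u \<bullet> z) + r * (v \<bullet> z)) * 1 \<partial>\<mu>) =
      cos b * exp (- ((u + r *\<^sub>R v) \<bullet> Q (u + r *\<^sub>R v)) / 2)" for r
    using integral_cos_inner[of b "u + r *\<^sub>R v"] by (simp add: inner_add_left add.assoc)
  moreover have "((\<lambda>r. cos b * exp (- ((u + r *\<^sub>R v) \<bullet> Q (u + r *\<^sub>R v)) / 2)) has_real_derivative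
      cos b * (- (u \<bullet> Q v) * exp (- (u \<bullet> Q u) / 2))) (at 0)"
    by (intro DERIV_cmult exponent_derivative)
  ultimately have "(\<integral>z. - sin (b + u \<bullet> z) * ((v \<bullet> z) * 1) \<partial>\<mu>) = cos b * (- (u \<bullet> Q v) * exp (- (u \<bullet> Q u) / 2))"
    by (simp only:) (rule DERIV_unique)
  then show ?thesis by simp
qed

lemma stein_cos:
  "(\<integral>z. cos (b + u \<bullet> z) * (v \<bullet> z) \<partial>\<mu>) = - (u \<bullet> Q v) * (sin b * exp (- (u \<bullet> Q u) / 2))"
  using stein_sin[of "b + pi / 2" u v] by (simp add: sin_add cos_add)

text \<open>The same differentiation, applied to \<open>stein_sin\<close> along
  \<open>u + r *\<^sub>R v\<close>.\<close>

lemma stein_cos_sq: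
  "(\<integral>z. cos (b + u \<bullet> z) * (v \<bullet> z)\<^sup>2 \<partial>\<mu>) =
    (v \<bullet> Q v - (u \<bullet> Q v)\<^sup>2) * (cos b * exp (- (u \<bullet> Q u) / 2))"
proof -
  have "((\<lambda>r. \<integral>z. sin ((b + u \<bullet> z) + r * (v \<bullet> z)) * (v \<bullet> z) \<partial>\<mu>) has_real_derivative
      (\<integral>z. cos (b + u \<bullet> z) * ((v \<bullet> z) * (v \<bullet> z)) \<partial>\<mu>)) (at 0)"
    by (rule has_derivative_under_integral)
      (use integrable_inner_sq[of v] in \<open>auto intro!: integrable_inner derivative_eq_intros
        borel_measurable_continuous_onI continuous_intros simp: power2_eq_square\<close>)
  moreover have "(\<integral>z. sin ((b + u \<bullet> z) + r * (v \<bullet> z)) * (v \<bullet> z) \<partial>\<mu>) =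
      ((u \<bullet> Q v) + r * (v \<bullet> Q v)) * (cos b * exp (- ((u + r *\<^sub>R v) \<bullet> Q (u + r *\<^sub>R v)) / 2))" for r
    using stein_sin[of b "u + r *\<^sub>R v" v] by (simp add: inner_add_left add.assoc)
  moreover have "((\<lambda>r. ((u \<bullet> Q v) + r * (v \<bullet> Q v)) * (cos b * exp (- ((u + r *\<^sub>R v) \<bullet> Q (u + r *\<^sub>R v)) / 2)))
      has_real_derivative (v \<bullet> Q v) * (cos b * exp (- ((u + 0 *\<^sub>R v) \<bullet> Q (u + 0 *\<^sub>R v)) / 2)) +
        (cos b * (- (u \<bullet> Q v) * exp (- (u \<bullet> Q u) / 2))) * ((u \<bullet> Q v) + 0 * (v \<bullet> Q v))) (at 0)"
    by (rule DERIV_mult[OF _ DERIV_cmult[OF exponent_derivative]]) (auto intro!: derivative_eq_intros)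
  ultimately have "(\<integral>z. cos (b + u \<bullet> z) * ((v \<bullet> z) * (v \<bullet> z)) \<partial>\<mu>) =
      (v \<bullet> Q v) * (cos b * exp (- ((u + 0 *\<^sub>R v) \<bullet> Q (u + 0 *\<^sub>R v)) / 2)) +
        (cos b * (- (u \<bullet> Q v) * exp (- (u \<bullet> Q u) / 2))) * ((u \<bullet> Q v) + 0 * (v \<bullet> Q v))"
    by (simp only:) (rule DERIV_unique)
  then show ?thesis by (simp add: power2_eq_square algebra_simps)
qed

lemma integrable_bounded_mult:
  fixes f g :: "'h \<Rightarrow> real"
  assumes "f \<in> borel_measurable borel" "\<And>z. \<bar>f z\<bar> \<le> M" "integrable \<mu> g"
  shows "integrable \<mu> (\<lambda>z. f z * g z)"
proof (rule Bochner_Integration.integrable_bound[of _ "\<lambda>z. M * g z"])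
  show "(\<lambda>z. f z * g z) \<in> borel_measurable \<mu>" using assms(1) borel_measurable_integrable[OF assms(3)] by measurable
  show "AE z in \<mu>. norm (f z * g z) \<le> norm (M * g z)"
  proof (rule AE_I2)
    fix z
    have "\<bar>f z\<bar> * \<bar>g z\<bar> \<le> \<bar>M\<bar> * \<bar>g z\<bar>" using assms(2)[of z] by (intro mult_right_mono) auto
    then show "norm (f z * g z) \<le> norm (M * g z)" by (simp add: abs_mult)
  qed
qed (use assms in auto)

lemma abs_integral_bounded_mult_le:
  fixes f g :: "'h \<Rightarrow> real"
  assumes "f \<in> borel_measurable borel" "\<And>z. \<bar>f z\<bar> \<le> M" "integrable \<mu> g"
  shows "\<bar>\<integral>z. f z * g z \<partial>\<mu>\<bar> \<le> M * (\<integral>z. \<bar>g z\<bar> \<partial>\<mu>)"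
proof -
  have "\<bar>\<integral>z. f z * g z \<partial>\<mu>\<bar> \<le> (\<integral>z. \<bar>f z * g z\<bar> \<partial>\<mu>)" by (rule integral_abs_bound)
  also have "\<dots> \<le> (\<integral>z. M * \<bar>g z\<bar> \<partial>\<mu>)"
  proof (rule integral_mono)
    show "\<bar>f z * g z\<bar> \<le> M * \<bar>g z\<bar>" for z
      unfolding abs_mult by (intro mult_right_mono assms) simp
  qed (use assms integrable_bounded_mult[OF assms] in auto)
  finally show ?thesis by simp
qed

section \<open>Taylor estimate for translates of trigonometric polynomials\<close>

lemma trig_poly_shift: "trig_poly f \<Longrightarrow> trig_poly (\<lambda>z. f (z + h))"
proof (induction rule: trig_poly.induct)
  case (cos a u b)
  then show ?case using trig_poly.cos[of a u "b + u \<bullet> h"] by (simp add: inner_add_right ac_simps)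
qed (rule trig_poly.add)

lemma trig_poly_integrals:
  assumes "trig_poly f"
  shows "integrable \<mu> (\<lambda>z. f (z + h))" "integrable \<mu> (\<lambda>z. f (z + h) * (v \<bullet> z))"
    "integrable \<mu> (\<lambda>z. f (z + h) * ((v \<bullet> z)\<^sup>2 - c))"
proof -
  have f: "trig_poly (\<lambda>z. f (z + h))" by (rule trig_poly_shift[OF assms])
  obtain B where B: "\<And>z. \<bar>f z\<bar> \<le> B" using trig_poly_bounded[OF assms] by blast
  have "integrable \<mu> (\<lambda>z. f (z + h) * g z)" if "integrable \<mu> g" for g
    using integrable_bounded_mult[OF trig_poly_borel_measurable[OF f] _ that] B by blast
  from this[of "\<lambda>_. 1"] this[of "\<lambda>z. v \<bullet> z"] this[of "\<lambda>z. (v \<bullet> z)\<^sup>2 - c"]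
  show "integrable \<mu> (\<lambda>z. f (z + h))" "integrable \<mu> (\<lambda>z. f (z + h) * (v \<bullet> z))"
    "integrable \<mu> (\<lambda>z. f (z + h) * ((v \<bullet> z)\<^sup>2 - c))"
    using integrable_inner integrable_inner_sq by auto
qed

text \<open>The shift by \<open>r *\<^sub>R Q v\<close> changes a cosine only in its phase, by
  \<open>r * (u \<bullet> Q v)\<close>, and the Stein identities convert each phase derivative into
  a weight: \<open>v \<bullet> z\<close>, then the Hermite polynomial
  \<open>(v \<bullet> z)\<^sup>2 - v \<bullet> Q v\<close>.\<close>

lemma trig_poly_shift_derivatives:
  assumes "trig_poly f"
  shows "((\<lambda>r. \<integral>z. f (z + r *\<^sub>R Q v) \<partial>\<mu>) has_real_derivative (\<integral>z. f (z + r *\<^sub>R Q v) * (v \<bullet> z) \<partial>\<mu>)) (at r)"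
    and "((\<lambda>r. \<integral>z. f (z + r *\<^sub>R Q v) * (v \<bullet> z) \<partial>\<mu>) has_real_derivative
      (\<integral>z. f (z + r *\<^sub>R Q v) * ((v \<bullet> z)\<^sup>2 - v \<bullet> Q v) \<partial>\<mu>)) (at r)"
proof -
  have "((\<lambda>r. \<integral>z. f (z + r *\<^sub>R Q v) \<partial>\<mu>) has_real_derivative (\<integral>z. f (z + r *\<^sub>R Q v) * (v \<bullet> z) \<partial>\<mu>)) (at r) \<and>
    ((\<lambda>r. \<integral>z. f (z + r *\<^sub>R Q v) * (v \<bullet> z) \<partial>\<mu>) has_real_derivative
      (\<integral>z. f (z + r *\<^sub>R Q v) * ((v \<bullet> z)\<^sup>2 - v \<bullet> Q v) \<partial>\<mu>)) (at r)"
    using assms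
  proof (induction rule: trig_poly.induct)
    case (cos a u b)
    define \<beta> E where "\<beta> = u \<bullet> Q v" and "E = exp (- (u \<bullet> Q u) / 2)"
    have arg: "u \<bullet> (z + r *\<^sub>R Q v) + b = (b + r * \<beta>) + u \<bullet> z" for z r
      by (simp add: inner_add_right \<beta>_def)
    have int: "integrable \<mu> (\<lambda>z. cos (c + u \<bullet> z) * (v \<bullet> z)\<^sup>2)" "integrable \<mu> (\<lambda>z. cos (c + u \<bullet> z))" for c
      using integrable_bounded_mult[of "\<lambda>z. cos (c + u \<bullet> z)" 1 "\<lambda>z. (v \<bullet> z)\<^sup>2"] integrable_inner_sq
        integrable_bounded_mult[of "\<lambda>z. cos (c + u \<bullet> z)" 1 "\<lambda>z. 1"] by auto
    have "(\<integral>z. a * cos (u \<bullet> (z + r *\<^sub>R Q v) + b) \<partial>\<mu>) = a * (cos (b + r * \<beta>) * E)" for r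
      by (simp only: arg) (simp add: integral_cos_inner E_def)
    moreover have "(\<integral>z. a * cos (u \<bullet> (z + r *\<^sub>R Q v) + b) * (v \<bullet> z) \<partial>\<mu>) = a * (- \<beta> * (sin (b + r * \<beta>) * E))" for r
      by (simp only: arg mult.assoc) (simp add: stein_cos E_def \<beta>_def)
    moreover have "(\<integral>z. a * cos (u \<bullet> (z + r *\<^sub>R Q v) + b) * ((v \<bullet> z)\<^sup>2 - v \<bullet> Q v) \<partial>\<mu>) =
        a * (- \<beta>\<^sup>2 * (cos (b + r * \<beta>) * E))" for r
    proof -
      have "(\<integral>z. a * cos (u \<bullet> (z + r *\<^sub>R Q v) + b) * ((v \<bullet> z)\<^sup>2 - v \<bullet> Q v) \<partial>\<mu>) =
          a * (\<integral>z. cos ((b + r * \<beta>) + u \<bullet> z) * (v \<bullet> z)\<^sup>2 - cos ((b + r * \<beta>) + u \<bullet> z) * (v \<bullet> Q v) \<partial>\<mu>)"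
        by (simp only: arg mult.assoc integral_mult_right_zero) (simp only: right_diff_distrib)
      also have "\<dots> = a * ((\<integral>z. cos ((b + r * \<beta>) + u \<bullet> z) * (v \<bullet> z)\<^sup>2 \<partial>\<mu>) -
          (\<integral>z. cos ((b + r * \<beta>) + u \<bullet> z) \<partial>\<mu>) * (v \<bullet> Q v))"
        using int by simp
      also have "\<dots> = a * (- \<beta>\<^sup>2 * (cos (b + r * \<beta>) * E))"
        by (simp add: stein_cos_sq integral_cos_inner E_def \<beta>_def) (simp add: algebra_simps)
      finally show ?thesis .
    qed
    ultimately show ?case
      by (simp only:) (auto intro!: derivative_eq_intros simp: power2_eq_square)
  next
    case (add p q)
    note int = trig_poly_integrals[OF add.hyps(1)] trig_poly_integrals[OF add.hyps(2)]
    show ?case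
      using add.IH int by (auto simp: distrib_right intro!: DERIV_add)
  qed
  then show "((\<lambda>r. \<integral>z. f (z + r *\<^sub>R Q v) \<partial>\<mu>) has_real_derivative (\<integral>z. f (z + r *\<^sub>R Q v) * (v \<bullet> z) \<partial>\<mu>)) (at r)"
    "((\<lambda>r. \<integral>z. f (z + r *\<^sub>R Q v) * (v \<bullet> z) \<partial>\<mu>) has_real_derivative
      (\<integral>z. f (z + r *\<^sub>R Q v) * ((v \<bullet> z)\<^sup>2 - v \<bullet> Q v) \<partial>\<mu>)) (at r)" by auto
qed

text \<open>Lagrange remainder of order two. The Hermite weight has mean modulus at most
  \<open>2 * (v \<bullet> Q v)\<close>, and this 2 cancels the Taylor factor 1/2.\<close>

lemma trig_poly_shift_taylor:
  assumes f: "trig_poly f" "\<And>z. \<bar>f z\<bar> \<le> M"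
  shows "\<bar>(\<integral>z. f (z + s *\<^sub>R Q v) \<partial>\<mu>) - (\<integral>z. f z \<partial>\<mu>) - s * (\<integral>z. f z * (v \<bullet> z) \<partial>\<mu>)\<bar> \<le> s\<^sup>2 * (v \<bullet> Q v) * M"
proof -
  define J where "J n r = (if n = (0::nat) then \<integral>z. f (z + r *\<^sub>R Q v) \<partial>\<mu>
    else if n = 1 then \<integral>z. f (z + r *\<^sub>R Q v) * (v \<bullet> z) \<partial>\<mu>
    else \<integral>z. f (z + r *\<^sub>R Q v) * ((v \<bullet> z)\<^sup>2 - v \<bullet> Q v) \<partial>\<mu>)" for n r
  have "\<forall>m t. m < 2 \<and> \<bar>t\<bar> \<le> \<bar>s\<bar> \<longrightarrow> (J m has_real_derivative J (Suc m) t) (at t)"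
    using trig_poly_shift_derivatives[OF f(1), of v] by (auto simp: J_def[abs_def] less_2_cases_iff)
  from Maclaurin_bi_le[of J "J 0" 2 s, OF refl this]
  obtain t where "J 0 s = (\<Sum>m<2. J m 0 / fact m * s ^ m) + J 2 t / fact 2 * s ^ 2" by blast
  then have eq: "J 0 s - J 0 0 - s * J 1 0 = J 2 t * s\<^sup>2 / 2" by (simp add: numeral_2_eq_2)
  have "\<bar>J 2 t\<bar> \<le> M * (\<integral>z. \<bar>(v \<bullet> z)\<^sup>2 - v \<bullet> Q v\<bar> \<partial>\<mu>)"
    unfolding J_def using integrable_inner_sq[of v] f trig_poly_borel_measurable[OF trig_poly_shift[OF f(1)]]
    by (simp, intro abs_integral_bounded_mult_le) auto
  also have "\<dots> \<le> M * (\<integral>z. (v \<bullet> z)\<^sup>2 + v \<bullet> Q v \<partial>\<mu>)"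
  proof (intro mult_left_mono integral_mono)
    show "0 \<le> M" using f(2)[of 0] by linarith
    show "\<bar>(v \<bullet> z)\<^sup>2 - v \<bullet> Q v\<bar> \<le> (v \<bullet> z)\<^sup>2 + v \<bullet> Q v" for z
      using Q_nonneg[of v] zero_le_power2[of "v \<bullet> z"] by linarith
  qed (use integrable_inner_sq[of v] in auto)
  also have "\<dots> = 2 * (v \<bullet> Q v) * M"
    using integrable_inner_sq[of v] by (simp add: integral_inner_sq prob_space[simplified])
  finally have "\<bar>J 2 t\<bar> * s\<^sup>2 / 2 \<le> 2 * (v \<bullet> Q v) * M * s\<^sup>2 / 2"
    by (intro divide_right_mono mult_right_mono) auto
  then have "\<bar>J 0 s - J 0 0 - s * J 1 0\<bar> \<le> s\<^sup>2 * (v \<bullet> Q v) * M"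
    unfolding eq by (simp add: abs_mult mult_ac)
  then show ?thesis by (simp add: J_def)
qed

end

section \<open>White noise and shifts of the Gaussian measure\<close>

context centered_gaussian
begin

abbreviation R :: "'h \<Rightarrow> 'h" where "R \<equiv> op_sqrt Q"

lemma R_positive: "positive_operator R" and R_R: "R (R x) = Q x"
  using op_sqrt_is_op_sqrt[OF pos] by (auto simp: is_op_sqrt_def fun_eq_iff)

sublocale R: bounded_linear R
  using positive_operatorD(1)[OF R_positive] .

lemma R_sym: "R x \<bullet> y = x \<bullet> R y"
  by (rule positive_operatorD(2)[OF R_positive])

text \<open>The isometry behind the white noise map: the functional \<open>v \<bullet> z\<close> has
  L^2 norm \<open>norm (R v)\<close>, so it depends only on \<open>R v\<close>.\<close>

lemma variance_eq_norm_R: "v \<bullet> Q v = (norm (R v))\<^sup>2"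
  by (simp add: R_sym R_R power2_norm_eq_inner)

lemma R_pseudoinverse: "g \<in> range R \<Longrightarrow> R (pseudoinverse R g) = g"
  by (rule pseudoinverse_works(1)[OF R.bounded_linear])

lemma square_integrable_L1:
  fixes X :: "'h \<Rightarrow> real"
  assumes "X \<in> borel_measurable \<mu>" "integrable \<mu> (\<lambda>z. (X z)\<^sup>2)"
  shows "integrable \<mu> X" "(\<integral>z. \<bar>X z\<bar> \<partial>\<mu>)\<^sup>2 \<le> (\<integral>z. (X z)\<^sup>2 \<partial>\<mu>)"
proof -
  show X: "integrable \<mu> X" by (rule square_integrable_imp_integrable[OF assms])
  have "0 \<le> variance (\<lambda>z. \<bar>X z\<bar>)" by (rule variance_positive)
  also have "\<dots> = (\<integral>z. \<bar>X z\<bar>\<^sup>2 \<partial>\<mu>) - (\<integral>z. \<bar>X z\<bar> \<partial>\<mu>)\<^sup>2"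
    using X assms by (intro variance_eq) auto
  finally show "(\<integral>z. \<bar>X z\<bar> \<partial>\<mu>)\<^sup>2 \<le> (\<integral>z. (X z)\<^sup>2 \<partial>\<mu>)" by simp
qed

lemma integral_abs_inner_le: "(\<integral>z. \<bar>v \<bullet> z\<bar> \<partial>\<mu>) \<le> norm (R v)"
proof (rule power2_le_imp_le)
  show "(\<integral>z. \<bar>v \<bullet> z\<bar> \<partial>\<mu>)\<^sup>2 \<le> (norm (R v))\<^sup>2"
    using square_integrable_L1(2)[of "\<lambda>z. v \<bullet> z"] integrable_inner_sq[of v]
    by (simp add: integral_inner_sq variance_eq_norm_R)
qed simp

lemma nn_integral_inner_diff_sq:
  "(\<integral>\<^sup>+z. ennreal ((u \<bullet> z - v \<bullet> z)\<^sup>2) \<partial>\<mu>) = ennreal ((norm (R u - R v))\<^sup>2)"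
  using integrable_inner_sq[of "u - v"] integral_inner_sq[of "u - v"] variance_eq_norm_R[of "u - v"]
  by (subst nn_integral_eq_integral) (auto simp: inner_diff_left R.diff)

text \<open>Completeness of L^2 carried out by hand: geometrically fast approximation makes the
  increments summable in L^1, so the functionals converge almost everywhere, and Fatou's lemma
  upgrades this to convergence in L^2.\<close>

lemma white_noise_exists:
  assumes y: "y \<in> closure (range R)"
  shows "\<exists>w. is_white_noise Q \<mu> y w"
proof -
  have "\<exists>g. g \<in> range R \<and> dist g y < (1/2) ^ n" for n :: nat
    using y by (auto simp: closure_approachable)
  then obtain g where g: "\<And>n. g n \<in> range R" "\<And>n. dist (g n) y < (1/2) ^ n" by metis
  have "g \<longlonglongrightarrow> y"
  proof (rule metric_tendsto_imp_tendsto)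
    show "(\<lambda>n. (1/2) ^ n :: real) \<longlonglongrightarrow> 0" by (rule LIMSEQ_power_zero) simp
    show "\<forall>\<^sub>F n in sequentially. dist (g n) y \<le> dist ((1/2) ^ n :: real) 0"
      using g(2) by (intro always_eventually allI) (simp add: less_imp_le)
  qed
  have gg: "norm (g n - g m) \<le> 2 * (1/2) ^ n" if "n \<le> m" for n m
  proof -
    have "norm (g n - g m) \<le> dist (g n) y + dist (g m) y"
      using dist_triangle2[of "g n" "g m" y] by (simp add: dist_norm)
    also have "\<dots> \<le> (1/2) ^ n + (1/2) ^ m" using g(2)[of n] g(2)[of m] by linarith
    also have "(1/2) ^ m \<le> ((1/2) ^ n :: real)" using that by (intro power_decreasing) auto
    finally show ?thesis by simp
  qed
  define p where "p n = pseudoinverse R (g n)" for n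
  have Rp: "R (p n) = g n" for n unfolding p_def by (rule R_pseudoinverse[OF g(1)])
  have incr: "(\<integral>\<^sup>+z. ennreal \<bar>p (Suc n) \<bullet> z - p n \<bullet> z\<bar> \<partial>\<mu>) \<le> ennreal (2 * (1/2) ^ n)" for n
  proof -
    have "(\<integral>\<^sup>+z. ennreal \<bar>p (Suc n) \<bullet> z - p n \<bullet> z\<bar> \<partial>\<mu>) = ennreal (\<integral>z. \<bar>(p n - p (Suc n)) \<bullet> z\<bar> \<partial>\<mu>)"
      using integrable_inner[of "p n - p (Suc n)"]
      by (subst nn_integral_eq_integral[symmetric]) (auto simp: inner_diff_left abs_minus_commute)
    also have "\<dots> \<le> ennreal (2 * (1/2) ^ n)"
      using integral_abs_inner_le[of "p n - p (Suc n)"] gg[of n "Suc n"]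
      by (intro ennreal_leI) (simp add: R.diff Rp)
    finally show ?thesis .
  qed
  have "(\<integral>\<^sup>+z. (\<Sum>n. ennreal \<bar>p (Suc n) \<bullet> z - p n \<bullet> z\<bar>) \<partial>\<mu>) =
      (\<Sum>n. \<integral>\<^sup>+z. ennreal \<bar>p (Suc n) \<bullet> z - p n \<bullet> z\<bar> \<partial>\<mu>)"
    by (rule nn_integral_suminf) measurable
  also have "\<dots> \<le> (\<Sum>n. ennreal (2 * (1/2) ^ n))" by (intro suminf_le incr) auto
  also have "\<dots> < \<infinity>"
    by (subst suminf_ennreal2) (auto intro!: summable_mult summable_geometric)
  finally have "AE z in \<mu>. (\<Sum>n. ennreal \<bar>p (Suc n) \<bullet> z - p n \<bullet> z\<bar>) \<noteq> \<infinity>"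
    by (intro nn_integral_PInf_AE) auto
  then have conv: "AE z in \<mu>. (\<lambda>n. p n \<bullet> z) \<longlonglongrightarrow> lim (\<lambda>n. p n \<bullet> z)"
  proof eventually_elim
    case (elim z)
    then have "summable (\<lambda>n. \<bar>p (Suc n) \<bullet> z - p n \<bullet> z\<bar>)"
      by (intro summable_suminf_not_top) auto
    then have "summable (\<lambda>n. p (Suc n) \<bullet> z - p n \<bullet> z)" by (rule summable_rabs_cancel)
    then have "convergent (\<lambda>n. p n \<bullet> z - p 0 \<bullet> z)"
      unfolding summable_iff_convergent sum_lessThan_telescope[of "\<lambda>n. p n \<bullet> z"] .
    from convergent_add[OF this convergent_const[of "p 0 \<bullet> z"]]
    have "convergent (\<lambda>n. p n \<bullet> z)" by simp
    then show ?case by (simp add: convergent_LIMSEQ_iff)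
  qed
  \<comment> \<open>Where the sequence diverges, \<open>lim\<close> is an arbitrary value; this
    happens only on a null set, and \<open>w\<close> is measurable all the same.\<close>
  define w where "w z = lim (\<lambda>n. p n \<bullet> z)" for z
  have w: "w \<in> borel_measurable \<mu>" unfolding w_def by (intro borel_measurable_lim_metric) measurable
  have fatou: "(\<integral>\<^sup>+z. ennreal ((p n \<bullet> z - w z)\<^sup>2) \<partial>\<mu>) \<le> ennreal ((2 * (1/2) ^ n)\<^sup>2)" for n
  proof -
    have "(\<integral>\<^sup>+z. ennreal ((p n \<bullet> z - w z)\<^sup>2) \<partial>\<mu>) =
        (\<integral>\<^sup>+z. liminf (\<lambda>m. ennreal ((p n \<bullet> z - p m \<bullet> z)\<^sup>2)) \<partial>\<mu>)"
    proof (rule nn_integral_cong_AE)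
      show "AE z in \<mu>. ennreal ((p n \<bullet> z - w z)\<^sup>2) = liminf (\<lambda>m. ennreal ((p n \<bullet> z - p m \<bullet> z)\<^sup>2))"
        using conv
      proof eventually_elim
        case (elim z)
        have "(\<lambda>m. ennreal ((p n \<bullet> z - p m \<bullet> z)\<^sup>2)) \<longlonglongrightarrow> ennreal ((p n \<bullet> z - w z)\<^sup>2)"
          unfolding w_def by (intro tendsto_ennrealI tendsto_intros elim)
        then show ?case by (intro lim_imp_Liminf[symmetric]) auto
      qed
    qed
    also have "\<dots> \<le> liminf (\<lambda>m. \<integral>\<^sup>+z. ennreal ((p n \<bullet> z - p m \<bullet> z)\<^sup>2) \<partial>\<mu>)"
      by (rule nn_integral_liminf) measurable
    also have "\<dots> \<le> liminf (\<lambda>m. ennreal ((2 * (1/2) ^ n)\<^sup>2))"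
    proof (rule Liminf_mono)
      show "\<forall>\<^sub>F m in sequentially. (\<integral>\<^sup>+z. ennreal ((p n \<bullet> z - p m \<bullet> z)\<^sup>2) \<partial>\<mu>) \<le> ennreal ((2 * (1/2) ^ n)\<^sup>2)"
        using eventually_ge_at_top[of n]
      proof eventually_elim
        case (elim m)
        show ?case
          unfolding nn_integral_inner_diff_sq Rp by (intro ennreal_leI power_mono gg elim) auto
      qed
    qed
    also have "\<dots> = ennreal ((2 * (1/2) ^ n)\<^sup>2)" by (intro Liminf_const) auto
    finally show ?thesis .
  qed
  have "(\<lambda>n. \<integral>\<^sup>+z. ennreal ((p n \<bullet> z - w z)\<^sup>2) \<partial>\<mu>) \<longlonglongrightarrow> 0"
  proof (rule tendsto_sandwich[of "\<lambda>_. 0" _ _ "\<lambda>n. ennreal ((2 * (1/2) ^ n)\<^sup>2)"])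
    have "(\<lambda>n. (2 * (1/2) ^ n :: real)\<^sup>2) \<longlonglongrightarrow> (2 * 0)\<^sup>2"
      by (intro tendsto_intros LIMSEQ_power_zero) auto
    from tendsto_ennrealI[OF this]
    show "(\<lambda>n. ennreal ((2 * (1/2) ^ n)\<^sup>2)) \<longlonglongrightarrow> 0" by simp
  qed (use fatou in auto)
  then show ?thesis
    unfolding is_white_noise_def p_def
    \<comment> \<open>As \<open>y\<close> is already in the closure of the range, it is its own
      projection.\<close>
    using w g(1) \<open>g \<longlonglongrightarrow> y\<close> by (intro exI[of _ w] conjI exI[of _ y] exI[of _ g]) auto
qed

text \<open>\<open>v \<bullet> z\<close> represents the white noise of \<open>R v\<close>, so this
  is the isometry weakened from L^2 to L^1, which suffices against bounded \<open>f\<close>. It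
  holds for every representative \<open>w\<close>.\<close>

lemma white_noise_L1:
  assumes y: "y \<in> closure (range R)" and w: "is_white_noise Q \<mu> y w"
  shows "integrable \<mu> w" "(\<integral>z. \<bar>w z - v \<bullet> z\<bar> \<partial>\<mu>) \<le> norm (y - R v)"
proof -
  obtain y' g where g: "\<And>n. g n \<in> range R" "g \<longlonglongrightarrow> y'"
    and orth: "\<And>x. x \<in> range R \<Longrightarrow> (y - y') \<bullet> x = 0"
    and lim: "(\<lambda>n. \<integral>\<^sup>+z. ennreal ((pseudoinverse R (g n) \<bullet> z - w z)\<^sup>2) \<partial>\<mu>) \<longlonglongrightarrow> 0"
    using w by (auto simp: is_white_noise_def)
  have [measurable]: "w \<in> borel_measurable \<mu>" using w by (simp add: is_white_noise_def)
  \<comment> \<open>The projection \<open>y'\<close> is identified with \<open>y\<close>: their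
    difference lies in the closure of the range and is orthogonal to it.\<close>
  have "(y - y') \<bullet> x = 0" if x: "x \<in> closure (range R)" for x
  proof -
    obtain f where f: "\<And>n. f n \<in> range R" "f \<longlonglongrightarrow> x" using x unfolding closure_sequential by metis
    have "(\<lambda>n. (y - y') \<bullet> f n) \<longlonglongrightarrow> (y - y') \<bullet> x" by (intro tendsto_intros f)
    then show ?thesis using orth[OF f(1)] by (simp add: LIMSEQ_const_iff)
  qed
  moreover have "y' \<in> closure (range R)" using g unfolding closure_sequential by metis
  then have "y - y' \<in> closure (range R)"
    by (intro subspace_diff subspace_closure linear_subspace_image R.linear y) auto
  ultimately have "(y - y') \<bullet> (y - y') = 0" by blast
  then have "y' = y" by simp
  define X where "X n z = pseudoinverse R (g n) \<bullet> z - w z" for n z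
  define a where "a n = (\<integral>\<^sup>+z. ennreal ((X n z)\<^sup>2) \<partial>\<mu>)" for n
  have X [measurable]: "X n \<in> borel_measurable \<mu>" for n unfolding X_def by measurable
  have a: "a \<longlonglongrightarrow> 0" using lim by (simp add: a_def[abs_def] X_def)
  \<comment> \<open>\<open>enn2real\<close> sends infinity to 0, so the bounds on \<open>X n\<close>
    make sense only for the indices with finite \<open>a n\<close>.\<close>
  have ev: "\<forall>\<^sub>F n in sequentially. a n < \<infinity>" by (rule order_tendstoD[OF a]) simp
  have X_int: "integrable \<mu> (X n)" "(\<integral>z. \<bar>X n z\<bar> \<partial>\<mu>) \<le> sqrt (enn2real (a n))" if "a n < \<infinity>" for n
  proof -
    have sq: "integrable \<mu> (\<lambda>z. (X n z)\<^sup>2)"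
      using that by (intro integrableI_nonneg) (auto simp: a_def)
    show "integrable \<mu> (X n)" by (rule square_integrable_L1(1)[OF X sq])
    have "(\<integral>z. (X n z)\<^sup>2 \<partial>\<mu>) = enn2real (a n)"
      unfolding a_def by (rule integral_eq_nn_integral) auto
    then show "(\<integral>z. \<bar>X n z\<bar> \<partial>\<mu>) \<le> sqrt (enn2real (a n))"
      using square_integrable_L1(2)[OF X sq] by (intro real_le_rsqrt) simp
  qed
  obtain n0 where n0: "a n0 < \<infinity>" using ev by (auto simp: eventually_sequentially)
  have "integrable \<mu> (\<lambda>z. pseudoinverse R (g n0) \<bullet> z - X n0 z)"
    using X_int(1)[OF n0] integrable_inner by (intro Bochner_Integration.integrable_diff)
  then show wint: "integrable \<mu> w" by (simp add: X_def)
  have "\<forall>\<^sub>F n in sequentially. (\<integral>z. \<bar>w z - v \<bullet> z\<bar> \<partial>\<mu>) \<le> sqrt (enn2real (a n)) + norm (g n - R v)"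
    using ev
  proof eventually_elim
    case (elim n)
    have "(\<integral>z. \<bar>w z - v \<bullet> z\<bar> \<partial>\<mu>) \<le> (\<integral>z. \<bar>X n z\<bar> + \<bar>(pseudoinverse R (g n) - v) \<bullet> z\<bar> \<partial>\<mu>)"
    proof (rule integral_mono)
      show "\<bar>w z - v \<bullet> z\<bar> \<le> \<bar>X n z\<bar> + \<bar>(pseudoinverse R (g n) - v) \<bullet> z\<bar>" for z
        by (simp add: X_def inner_diff_left)
    qed (use wint X_int[OF elim] integrable_inner in auto)
    also have "\<dots> = (\<integral>z. \<bar>X n z\<bar> \<partial>\<mu>) + (\<integral>z. \<bar>(pseudoinverse R (g n) - v) \<bullet> z\<bar> \<partial>\<mu>)"
      using X_int[OF elim] integrable_inner by (intro Bochner_Integration.integral_add) auto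
    also have "\<dots> \<le> sqrt (enn2real (a n)) + norm (R (pseudoinverse R (g n) - v))"
      by (intro add_mono X_int elim integral_abs_inner_le)
    finally show ?case by (simp add: R.diff R_pseudoinverse g)
  qed
  moreover have "(\<lambda>n. sqrt (enn2real (a n)) + norm (g n - R v)) \<longlonglongrightarrow> sqrt 0 + norm (y - R v)"
    using g(2) a \<open>y' = y\<close>
    by (intro tendsto_intros) (auto intro: tendsto_enn2real[of _ 0, simplified])
  ultimately show "(\<integral>z. \<bar>w z - v \<bullet> z\<bar> \<partial>\<mu>) \<le> norm (y - R v)"
    using tendsto_lowerbound[of _ "norm (y - R v)" sequentially] by simp
qed

lemma is_white_noise_white_noise:
  "y \<in> closure (range R) \<Longrightarrow> is_white_noise Q \<mu> y (white_noise Q \<mu> y)"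
  using white_noise_exists unfolding white_noise_def by (rule someI_ex)

lemma integral_white_noise_diff_le:
  fixes f :: "'h \<Rightarrow> real"
  assumes "y \<in> closure (range R)" "is_white_noise Q \<mu> y w"
    and f: "f \<in> borel_measurable borel" "\<And>z. \<bar>f z\<bar> \<le> M"
  shows "\<bar>(\<integral>z. f z * w z \<partial>\<mu>) - (\<integral>z. f z * (v \<bullet> z) \<partial>\<mu>)\<bar> \<le> M * norm (y - R v)"
proof -
  note w = white_noise_L1[OF assms(1,2)]
  have M: "0 \<le> M" using f(2)[of 0] by linarith
  have "(\<integral>z. f z * w z \<partial>\<mu>) - (\<integral>z. f z * (v \<bullet> z) \<partial>\<mu>) = (\<integral>z. f z * (w z - v \<bullet> z) \<partial>\<mu>)"
    using integrable_bounded_mult[OF f w(1)] integrable_bounded_mult[OF f integrable_inner]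
    by (simp add: right_diff_distrib)
  also have "\<bar>\<dots>\<bar> \<le> M * (\<integral>z. \<bar>w z - v \<bullet> z\<bar> \<partial>\<mu>)"
    using w(1) integrable_inner by (intro abs_integral_bounded_mult_le f) auto
  also have "\<dots> \<le> M * norm (y - R v)" by (intro mult_left_mono w M)
  finally show ?thesis .
qed

text \<open>For \<open>R (p n) = g n\<close> the shift is \<open>Q (p n) = R (g n)\<close> and the
  variance is \<open>(norm (g n))\<^sup>2\<close>. Every term of the previous estimate converges
  with \<open>g n\<close>, even if \<open>p n\<close> does not.\<close>

lemma trig_poly_shift_taylor_white_noise:
  assumes y: "y \<in> closure (range R)" and w: "is_white_noise Q \<mu> y w"
    and f: "trig_poly f" "\<And>z. \<bar>f z\<bar> \<le> M"
  shows "\<bar>(\<integral>z. f (z + s *\<^sub>R R y) \<partial>\<mu>) - (\<integral>z. f z \<partial>\<mu>) - s * (\<integral>z. f z * w z \<partial>\<mu>)\<bar> \<le> s\<^sup>2 * (norm y)\<^sup>2 * M"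
proof -
  note [measurable] = trig_poly_borel_measurable[OF f(1)]
  have f_meas: "f \<in> borel_measurable borel" by measurable
  obtain g where g: "\<And>n. g n \<in> range R" "g \<longlonglongrightarrow> y" using y unfolding closure_sequential by metis
  define p where "p n = pseudoinverse R (g n)" for n
  have Rp: "R (p n) = g n" "Q (p n) = R (g n)" for n
    using R_pseudoinverse[OF g(1), of n] R_R[of "p n"] by (simp_all add: p_def)
  have "(\<lambda>n. \<integral>z. f (z + s *\<^sub>R R (g n)) \<partial>\<mu>) \<longlonglongrightarrow> (\<integral>z. f (z + s *\<^sub>R R y) \<partial>\<mu>)"
  proof (rule integral_dominated_convergence[where w = "\<lambda>_. M"])
    have "isCont f x" for x
      using trig_poly_continuous_on[OF f(1), of UNIV] by (simp add: continuous_on_eq_continuous_at)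
    moreover have "(\<lambda>n. z + s *\<^sub>R R (g n)) \<longlonglongrightarrow> z + s *\<^sub>R R y" for z
      by (intro tendsto_intros R.tendsto g)
    ultimately have "(\<lambda>n. f (z + s *\<^sub>R R (g n))) \<longlonglongrightarrow> f (z + s *\<^sub>R R y)" for z
      by (rule isCont_tendsto_compose[of "z + s *\<^sub>R R y" f])
    then show "AE z in \<mu>. (\<lambda>n. f (z + s *\<^sub>R R (g n))) \<longlonglongrightarrow> f (z + s *\<^sub>R R y)" by (rule AE_I2)
  qed (use f in auto)
  moreover have "(\<lambda>n. \<integral>z. f z * (p n \<bullet> z) \<partial>\<mu>) \<longlonglongrightarrow> (\<integral>z. f z * w z \<partial>\<mu>)"
  proof (rule metric_tendsto_imp_tendsto)
    have "(\<lambda>n. M * norm (y - g n)) \<longlonglongrightarrow> M * norm (y - y)" by (intro tendsto_intros g)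
    then show "(\<lambda>n. M * norm (y - g n)) \<longlonglongrightarrow> 0" by simp
    have le: "dist (\<integral>z. f z * (p n \<bullet> z) \<partial>\<mu>) (\<integral>z. f z * w z \<partial>\<mu>) \<le> M * norm (y - g n)" for n
      using integral_white_noise_diff_le[OF y w f_meas f(2), of "p n"]
      by (simp add: dist_real_def Rp abs_minus_commute)
    show "\<forall>\<^sub>F n in sequentially. dist (\<integral>z. f z * (p n \<bullet> z) \<partial>\<mu>) (\<integral>z. f z * w z \<partial>\<mu>) \<le> dist (M * norm (y - g n)) 0"
      by (intro always_eventually allI order_trans[OF le]) (simp only: dist_real_def diff_0_right abs_ge_self)
  qed
  ultimately have "(\<lambda>n. \<bar>(\<integral>z. f (z + s *\<^sub>R R (g n)) \<partial>\<mu>) - (\<integral>z. f z \<partial>\<mu>) - s * (\<integral>z. f z * (p n \<bullet> z) \<partial>\<mu>)\<bar>)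
      \<longlonglongrightarrow> \<bar>(\<integral>z. f (z + s *\<^sub>R R y) \<partial>\<mu>) - (\<integral>z. f z \<partial>\<mu>) - s * (\<integral>z. f z * w z \<partial>\<mu>)\<bar>"
    by (intro tendsto_intros)
  moreover have "(\<lambda>n. s\<^sup>2 * (norm (g n))\<^sup>2 * M) \<longlonglongrightarrow> s\<^sup>2 * (norm y)\<^sup>2 * M" by (intro tendsto_intros g)
  moreover have "\<bar>(\<integral>z. f (z + s *\<^sub>R R (g n)) \<partial>\<mu>) - (\<integral>z. f z \<partial>\<mu>) - s * (\<integral>z. f z * (p n \<bullet> z) \<partial>\<mu>)\<bar>
      \<le> s\<^sup>2 * (norm (g n))\<^sup>2 * M" for n
    using trig_poly_shift_taylor[OF f, of s "p n", unfolded variance_eq_norm_R] by (simp only: Rp)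
  ultimately show ?thesis by (meson LIMSEQ_le)
qed

text \<open>The approximation is carried out for the mixture of \<open>\<mu>\<close> and its translate by \<open>k\<close>, which is
  not yet known to be absolutely continuous.\<close>

lemma trig_poly_approx_AE:
  fixes f :: "'h \<Rightarrow> real"
  assumes f: "f \<in> borel_measurable borel" "\<And>z. \<bar>f z\<bar> \<le> M"
  shows "\<exists>p. (\<forall>n. trig_poly (p n) \<and> (\<forall>z. \<bar>p n z\<bar> \<le> M + 1 / real (Suc n))) \<and>
    (AE z in \<mu>. (\<lambda>n. p n z) \<longlonglongrightarrow> f z) \<and> (AE z in \<mu>. (\<lambda>n. p n (z + k)) \<longlonglongrightarrow> f (z + k))"
proof -
  \<comment> \<open>The mixture is realized as the law of \<open>z\<close> or \<open>z + k\<close>,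
    selected by a fair coin.\<close>
  define B where "B = measure_pmf (bernoulli_pmf (1/2))"
  interpret B: prob_space B unfolding B_def by (rule prob_space_measure_pmf)
  interpret P: pair_prob_space B \<mu> ..
  define \<nu> where "\<nu> = distr (B \<Otimes>\<^sub>M \<mu>) borel (\<lambda>x. if fst x then snd x + k else snd x)"
  have sets_B [measurable_cong]: "sets B = sets (count_space UNIV)" by (simp add: B_def)
  have meas [measurable]: "(\<lambda>x. if fst x then snd x + k else snd x) \<in> measurable (B \<Otimes>\<^sub>M \<mu>) borel"
    by measurable
  interpret \<nu>: prob_space \<nu> unfolding \<nu>_def by (rule P.prob_space_distr[OF meas])
  have sets_\<nu>: "sets \<nu> = sets borel" by (simp add: \<nu>_def)
  have f\<nu>: "f \<in> borel_measurable \<nu>" using f(1) sets_\<nu> by (simp cong: measurable_cong_sets)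
  have "\<exists>p. trig_poly p \<and> (\<forall>z. \<bar>p z\<bar> \<le> M + 1 / real (Suc n)) \<and> (\<integral>z. \<bar>f z - p z\<bar> \<partial>\<nu>) < 1 / real (Suc n)" for n
    by (rule trig_poly_approx_bounded[OF \<nu>.finite_measure_axioms sets_\<nu> f\<nu> f(2), of "1 / real (Suc n)"]) auto
  then obtain p where p: "\<And>n. trig_poly (p n)" "\<And>n z. \<bar>p n z\<bar> \<le> M + 1 / real (Suc n)"
    "\<And>n. (\<integral>z. \<bar>f z - p n z\<bar> \<partial>\<nu>) < 1 / real (Suc n)" by metis
  have fint: "integrable \<nu> f" using f(2) f\<nu> by (intro \<nu>.integrable_const_bound[of _ M]) auto
  have int: "integrable \<nu> (\<lambda>z. f z - p n z)" for n
    by (intro Bochner_Integration.integrable_diff fint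
        integrable_trig_poly[OF \<nu>.finite_measure_axioms sets_\<nu> p(1)])
  have "(\<lambda>n. \<integral>z. norm (f z - p n z) \<partial>\<nu>) \<longlonglongrightarrow> 0"
  proof (rule tendsto_sandwich[of "\<lambda>_. 0" _ _ "\<lambda>n. 1 / real (Suc n)"])
    show "(\<lambda>n. 1 / real (Suc n)) \<longlonglongrightarrow> 0" using LIMSEQ_Suc[OF lim_1_over_n] .
  qed (use p(3) in \<open>auto intro!: always_eventually less_imp_le simp del: of_nat_Suc\<close>)
  \<comment> \<open>Extraction under \<open>\<nu>\<close> yields one subsequence for both measures
    at once.\<close>
  from tendsto_L1_AE_subseq[OF int this]
  obtain r :: "nat \<Rightarrow> nat" where r: "strict_mono r" "AE z in \<nu>. (\<lambda>n. f z - p (r n) z) \<longlonglongrightarrow> 0" by blast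
  from r(2) have "AE z in \<nu>. (\<lambda>n. p (r n) z) \<longlonglongrightarrow> f z"
  proof eventually_elim
    case (elim z)
    have "(\<lambda>n. f z - (f z - p (r n) z)) \<longlonglongrightarrow> f z - 0" by (intro tendsto_intros elim)
    then show ?case by simp
  qed
  then have "AE x in B \<Otimes>\<^sub>M \<mu>. (\<lambda>n. p (r n) (if fst x then snd x + k else snd x))
      \<longlonglongrightarrow> f (if fst x then snd x + k else snd x)"
    unfolding \<nu>_def by (rule AE_distrD[OF meas])
  \<comment> \<open>Both outcomes of the coin have positive probability, so almost every
    \<open>b\<close> means both values of \<open>b\<close>.\<close>
  then have "AE b in B. AE z in \<mu>. (\<lambda>n. p (r n) (if b then z + k else z)) \<longlonglongrightarrow> f (if b then z + k else z)"
    by (drule_tac P.AE_pair) (simp only: fst_conv snd_conv)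
  then have "AE z in \<mu>. (\<lambda>n. p (r n) (if b then z + k else z)) \<longlonglongrightarrow> f (if b then z + k else z)" for b
    unfolding B_def AE_measure_pmf_iff by simp
  from this[of False] this[of True]
  have "AE z in \<mu>. (\<lambda>n. p (r n) z) \<longlonglongrightarrow> f z" "AE z in \<mu>. (\<lambda>n. p (r n) (z + k)) \<longlonglongrightarrow> f (z + k)" by simp_all
  moreover have "\<bar>p (r n) z\<bar> \<le> M + 1 / real (Suc n)" for n z
  proof -
    have "1 / real (Suc (r n)) \<le> 1 / real (Suc n)"
      using seq_suble[OF r(1), of n] by (intro divide_left_mono) auto
    then show ?thesis using p(2)[of "r n" z] by linarith
  qed
  ultimately show ?thesis using p(1) by (intro exI[of _ "\<lambda>n. p (r n)"]) blast
qed

text \<open>Dominated convergence along the approximants: the translated integral needs their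
  convergence under the translate, the other two under \<open>\<mu>\<close>. Their bounds
  \<open>M + 1 / real (Suc n)\<close> leave exactly \<open>M\<close> in the limit.\<close>

proposition shift_taylor_white_noise:
  fixes f :: "'h \<Rightarrow> real"
  assumes y: "y \<in> closure (range R)" and w: "is_white_noise Q \<mu> y w"
    and f: "f \<in> borel_measurable borel" "\<And>z. \<bar>f z\<bar> \<le> M"
  shows "\<bar>(\<integral>z. f (z + s *\<^sub>R R y) \<partial>\<mu>) - (\<integral>z. f z \<partial>\<mu>) - s * (\<integral>z. f z * w z \<partial>\<mu>)\<bar> \<le> s\<^sup>2 * (norm y)\<^sup>2 * M"
proof -
  have [measurable]: "w \<in> borel_measurable \<mu>" using w by (simp add: is_white_noise_def)
  have wint: "integrable \<mu> w" by (rule white_noise_L1(1)[OF y w])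
  note [measurable] = f(1)
  obtain p where p: "\<And>n. trig_poly (p n)" "\<And>n z. \<bar>p n z\<bar> \<le> M + 1 / real (Suc n)"
    "AE z in \<mu>. (\<lambda>n. p n z) \<longlonglongrightarrow> f z"
    "AE z in \<mu>. (\<lambda>n. p n (z + s *\<^sub>R R y)) \<longlonglongrightarrow> f (z + s *\<^sub>R R y)"
    using trig_poly_approx_AE[OF f, of "s *\<^sub>R R y"] by blast
  have [measurable]: "p n \<in> borel_measurable borel" for n by (rule trig_poly_borel_measurable[OF p(1)])
  have bound: "\<bar>p n z\<bar> \<le> M + 1" for n z
  proof -
    have "1 / real (Suc n) \<le> 1" by simp
    then show ?thesis using p(2)[of n z] by linarith
  qed
  have "(\<lambda>n. \<integral>z. p n (z + s *\<^sub>R R y) \<partial>\<mu>) \<longlonglongrightarrow> (\<integral>z. f (z + s *\<^sub>R R y) \<partial>\<mu>)"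
    by (rule integral_dominated_convergence[where w = "\<lambda>_. M + 1"]) (use p(4) bound in auto)
  moreover have "(\<lambda>n. \<integral>z. p n z \<partial>\<mu>) \<longlonglongrightarrow> (\<integral>z. f z \<partial>\<mu>)"
    by (rule integral_dominated_convergence[where w = "\<lambda>_. M + 1"]) (use p(3) bound in auto)
  moreover have "(\<lambda>n. \<integral>z. p n z * w z \<partial>\<mu>) \<longlonglongrightarrow> (\<integral>z. f z * w z \<partial>\<mu>)"
  proof (rule integral_dominated_convergence[where w = "\<lambda>z. (M + 1) * \<bar>w z\<bar>"])
    show "AE z in \<mu>. (\<lambda>n. p n z * w z) \<longlonglongrightarrow> f z * w z"
      using p(3) by eventually_elim (rule tendsto_mult_right)
    show "AE z in \<mu>. norm (p n z * w z) \<le> (M + 1) * \<bar>w z\<bar>" for n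
      by (intro AE_I2) (simp add: abs_mult mult_right_mono bound)
  qed (use wint in auto)
  ultimately have "(\<lambda>n. \<bar>(\<integral>z. p n (z + s *\<^sub>R R y) \<partial>\<mu>) - (\<integral>z. p n z \<partial>\<mu>) - s * (\<integral>z. p n z * w z \<partial>\<mu>)\<bar>)
      \<longlonglongrightarrow> \<bar>(\<integral>z. f (z + s *\<^sub>R R y) \<partial>\<mu>) - (\<integral>z. f z \<partial>\<mu>) - s * (\<integral>z. f z * w z \<partial>\<mu>)\<bar>"
    by (intro tendsto_intros)
  moreover have "(\<lambda>n. s\<^sup>2 * (norm y)\<^sup>2 * (M + 1 / real (Suc n))) \<longlonglongrightarrow> s\<^sup>2 * (norm y)\<^sup>2 * (M + 0)"
    by (intro tendsto_intros LIMSEQ_Suc[OF lim_1_over_n])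
  moreover have "\<bar>(\<integral>z. p n (z + s *\<^sub>R R y) \<partial>\<mu>) - (\<integral>z. p n z \<partial>\<mu>) - s * (\<integral>z. p n z * w z \<partial>\<mu>)\<bar>
      \<le> s\<^sup>2 * (norm y)\<^sup>2 * (M + 1 / real (Suc n))" for n
    by (rule trig_poly_shift_taylor_white_noise[OF y w p(1,2)])
  ultimately have "\<bar>(\<integral>z. f (z + s *\<^sub>R R y) \<partial>\<mu>) - (\<integral>z. f z \<partial>\<mu>) - s * (\<integral>z. f z * w z \<partial>\<mu>)\<bar>
      \<le> s\<^sup>2 * (norm y)\<^sup>2 * (M + 0)"
    by (meson LIMSEQ_le)
  then show ?thesis by simp
qed

end

section \<open>The gradient as a bounded functional\<close>

context centered_gaussian
begin

lemma abs_integral_white_noise_le: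
  fixes f :: "'h \<Rightarrow> real"
  assumes y: "y \<in> closure (range R)" and f: "f \<in> borel_measurable borel" "\<And>z. \<bar>f z\<bar> \<le> M"
  shows "\<bar>\<integral>z. f z * white_noise Q \<mu> y z \<partial>\<mu>\<bar> \<le> M * norm y"
  using integral_white_noise_diff_le[OF y is_white_noise_white_noise[OF y] f, of 0] by simp

text \<open>The representatives chosen by \<open>white_noise\<close> for \<open>y\<close>,
  \<open>y'\<close> and \<open>y + y'\<close> are unrelated as functions. The integral
  \<open>l y\<close>, however, is the limit of the linear expressions \<open>m (v n)\<close> for
  every sequence with \<open>R (v n)\<close> tending to \<open>y\<close>, and so linearity passes to
  \<open>l\<close>.\<close>

lemma bounded_linear_integral_white_noise:
  fixes f :: "'h \<Rightarrow> real" and T :: "'k::real_normed_vector \<Rightarrow> 'h"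
  assumes T: "bounded_linear T" "\<And>k. T k \<in> closure (range R)"
    and f: "f \<in> borel_measurable borel" "\<And>z. \<bar>f z\<bar> \<le> M"
  shows "bounded_linear (\<lambda>k. \<integral>z. f z * white_noise Q \<mu> (T k) z \<partial>\<mu>)"
proof -
  interpret T: bounded_linear T by fact
  define l where "l y = (\<integral>z. f z * white_noise Q \<mu> y z \<partial>\<mu>)" for y
  define m where "m v = (\<integral>z. f z * (v \<bullet> z) \<partial>\<mu>)" for v
  have M: "0 \<le> M" using f(2)[of 0] by linarith
  have lm: "\<bar>l y - m v\<bar> \<le> M * norm (y - R v)" if "y \<in> closure (range R)" for y v
    unfolding l_def m_def
    by (rule integral_white_noise_diff_le[OF that is_white_noise_white_noise[OF that] f])
  have m_add: "m (u + v) = m u + m v" for u v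
    using integrable_bounded_mult[OF f integrable_inner] by (simp add: m_def inner_add_left distrib_left)
  have m_scale: "m (r *\<^sub>R v) = r * m v" for r v
    by (simp add: m_def mult.left_commute)
  have seq: "\<exists>v. (\<lambda>n. R (v n)) \<longlonglongrightarrow> y" if y: "y \<in> closure (range R)" for y
  proof -
    obtain g where g: "\<And>n. g n \<in> range R" "g \<longlonglongrightarrow> y" using y unfolding closure_sequential by metis
    then have "(\<lambda>n. R (pseudoinverse R (g n))) \<longlonglongrightarrow> y" by (simp add: R_pseudoinverse)
    then show ?thesis by (rule exI[of _ "\<lambda>n. pseudoinverse R (g n)"])
  qed
  have lim: "(\<lambda>n. m (v n)) \<longlonglongrightarrow> l y" if y: "y \<in> closure (range R)" and v: "(\<lambda>n. R (v n)) \<longlonglongrightarrow> y" for y v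
  proof -
    have "(\<lambda>n. M * norm (y - R (v n))) \<longlonglongrightarrow> M * norm (y - y)" by (intro tendsto_intros v)
    then have "(\<lambda>n. M * norm (y - R (v n))) \<longlonglongrightarrow> 0" by simp
    then have "(\<lambda>n. l y - m (v n)) \<longlonglongrightarrow> 0"
      by (rule Lim_null_comparison[rotated]) (use lm[OF y] in \<open>auto intro!: always_eventually\<close>)
    from tendsto_diff[OF tendsto_const[of "l y"] this] show ?thesis by simp
  qed
  show ?thesis
    unfolding l_def[symmetric]
  proof (rule bounded_linear_intro)
    fix j k
    obtain u v where u: "(\<lambda>n. R (u n)) \<longlonglongrightarrow> T j" and v: "(\<lambda>n. R (v n)) \<longlonglongrightarrow> T k"
      using seq T(2) by metis
    have "(\<lambda>n. R (u n + v n)) \<longlonglongrightarrow> T (j + k)" unfolding R.add T.add by (intro tendsto_add u v)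
    then have "(\<lambda>n. m (u n + v n)) \<longlonglongrightarrow> l (T (j + k))" by (rule lim[OF T(2)])
    moreover have "(\<lambda>n. m (u n + v n)) \<longlonglongrightarrow> l (T j) + l (T k)"
      unfolding m_add by (intro tendsto_add lim T u v)
    ultimately show "l (T (j + k)) = l (T j) + l (T k)" by (rule LIMSEQ_unique)
  next
    fix r k
    obtain v where v: "(\<lambda>n. R (v n)) \<longlonglongrightarrow> T k" using seq T(2) by metis
    have "(\<lambda>n. R (r *\<^sub>R v n)) \<longlonglongrightarrow> T (r *\<^sub>R k)" unfolding R.scaleR T.scaleR by (intro tendsto_intros v)
    then have "(\<lambda>n. m (r *\<^sub>R v n)) \<longlonglongrightarrow> l (T (r *\<^sub>R k))" by (rule lim[OF T(2)])
    moreover have "(\<lambda>n. m (r *\<^sub>R v n)) \<longlonglongrightarrow> r * l (T k)"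
      unfolding m_scale by (intro tendsto_intros lim T v)
    ultimately show "l (T (r *\<^sub>R k)) = r *\<^sub>R l (T k)" by (simp add: LIMSEQ_unique)
  next
    fix k
    have "\<bar>l (T k)\<bar> \<le> M * norm (T k)" unfolding l_def by (rule abs_integral_white_noise_le[OF T(2) f])
    also have "\<dots> \<le> M * (onorm T * norm k)" by (intro mult_left_mono onorm[OF T(1)] M)
    finally show "norm (l (T k)) \<le> norm k * (onorm T * M)" by (simp add: mult_ac)
  qed
qed

end

section \<open>The Ornstein-Uhlenbeck semigroup\<close>

lemma C_gradient_eqI:
  fixes f :: "'h::real_inner \<Rightarrow> real" and g :: "'k::{real_inner, banach}"
  assumes D: "closure D = UNIV" and g: "has_C_gateaux_derivative D C f x (\<lambda>k. g \<bullet> k)"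
  shows "C_gradient D C f x = g"
  unfolding C_gradient_def
proof (rule the_equality)
  fix g' assume g': "has_C_gateaux_derivative D C f x (\<lambda>k. g' \<bullet> k)"
  have eq: "(g' - g) \<bullet> k = 0" if "k \<in> D" for k
  proof -
    have "g' \<bullet> k = g \<bullet> k"
      using g g' that tendsto_unique[OF at_neq_bot]
      unfolding has_C_gateaux_derivative_def has_C_dir_derivative_def by blast
    then show ?thesis by (simp add: inner_diff_left)
  qed
  have "closed {k. (g' - g) \<bullet> k = 0}" by (intro closed_Collect_eq continuous_intros)
  then have "closure D \<subseteq> {k. (g' - g) \<bullet> k = 0}" using eq by (intro closure_minimal) auto
  then have "(g' - g) \<bullet> (g' - g) = 0" using D by blast
  then show "g' = g" by simp
qed (rule g)

theorem theorem4p1: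
  fixes S :: "real \<Rightarrow> 'h \<Rightarrow> 'h::{real_inner, banach, second_countable_topology}"
    and A :: "'h \<Rightarrow> 'h" and DA :: "'h set"
    and G :: "'x::{real_inner, banach, second_countable_topology} \<Rightarrow> 'h"
    and P :: "'h \<Rightarrow> 'h"
    and C :: "'k::{real_inner, banach, second_countable_topology} \<Rightarrow> 'h" and D :: "'k set"
    and \<phi>bar :: "'h \<Rightarrow> real"
    and t :: real
    and \<mu> :: "'h measure"
    and PSC :: "'k \<Rightarrow> 'h"
  defines "Q \<equiv> Q_op S G t"
  defines "R\<phi> \<equiv> OU_semigroup S \<mu> t (\<lambda>x. \<phi>bar (P x))"
  assumes semigroup: "C0_semigroup S" "generator DA A S"
    and G: "bounded_linear G"
    and P: "bounded_linear P"
    and C: "densely_defined_operator D C"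
    and \<phi>bar: "\<phi>bar \<in> borel_measurable (restrict_space borel (range P))"
              "bounded (\<phi>bar ` range P)"
    and t: "t > 0"
    and Q: "trace_class Q"
    and \<mu>: "gaussian_measure 0 Q \<mu>"
    and PSC: "bounded_linear PSC" "\<And>k. k \<in> D \<Longrightarrow> PSC k = P (S t (C k))"
    and P_id: "\<And>k. k \<in> D \<Longrightarrow> P (P (S t (C k))) = P (S t (C k))"
    and range: "range PSC \<subseteq> range (op_sqrt Q)"
  shows "C_frechet_differentiable D C R\<phi> \<and>
    (\<forall>x k. C_gradient D C R\<phi> x \<bullet> k =
       (LINT z|\<mu>. \<phi>bar (P z + P (S t x)) *
          white_noise Q \<mu> (pseudoinverse (op_sqrt Q) (PSC k)) z)) \<and>
    bounded_linear (\<lambda>k. pseudoinverse (op_sqrt Q) (PSC k)) \<and>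
    (\<forall>x k. \<bar>C_gradient D C R\<phi> x \<bullet> k\<bar> \<le>
       (SUP y\<in>range P. \<bar>\<phi>bar y\<bar>) * onorm (\<lambda>k. pseudoinverse (op_sqrt Q) (PSC k)) * norm k)"
proof -
  interpret P: bounded_linear P by (rule P)
  interpret St: bounded_linear "S t" using C0_semigroupD(1)[OF semigroup(1)] t by simp
  have "bounded_linear Q" using Q by (simp add: trace_class_def)
  then have Q_pos: "positive_operator Q"
    unfolding Q_def by (rule Q_op_positive[OF semigroup(1) G])
  interpret centered_gaussian Q \<mu>
  proof (intro centered_gaussian.intro centered_gaussian_axioms.intro Q_pos \<mu>)
    show "prob_space \<mu>" using \<mu> by (simp add: gaussian_measure_def)
  qed
  define T where "T k = pseudoinverse (op_sqrt Q) (PSC k)" for k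
  have T_lin: "bounded_linear T"
    unfolding T_def[abs_def] by (rule bounded_linear_pseudoinverse_comp[OF R.bounded_linear R_sym PSC(1) range])
  have PSC_range: "PSC k \<in> range R" for k using range by blast
  have RT: "R (T k) = PSC k" for k unfolding T_def by (rule R_pseudoinverse[OF PSC_range])
  \<comment> \<open>Preimages of least norm are orthogonal to the kernel of \<open>R\<close>, so the
    white noise estimates apply to \<open>T k\<close>.\<close>
  have T_cl: "T k \<in> closure (range R)" for k
    by (rule closure_range_symmetric[OF R.bounded_linear R_sym])
      (unfold T_def, rule pseudoinverse_works(2)[OF R.bounded_linear PSC_range])
  have T_norm: "norm (T k) \<le> onorm T * norm k" for k by (rule onorm[OF T_lin])
  define M where "M = (SUP y\<in>range P. \<bar>\<phi>bar y\<bar>)"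
  define f where "f x z = \<phi>bar (P z + P (S t x))" for x z
  have f_alt: "f x z = \<phi>bar (P (z + S t x))" for x z by (simp add: f_def P.add)
  \<comment> \<open>A real supremum bounds the values only if the set is bounded above.\<close>
  have "bdd_above ((\<lambda>y. \<bar>\<phi>bar y\<bar>) ` range P)"
  proof -
    obtain b where "\<And>y. y \<in> \<phi>bar ` range P \<Longrightarrow> norm y \<le> b" using \<phi>bar(2) unfolding bounded_iff by blast
    then show ?thesis by (intro bdd_aboveI[of _ b]) auto
  qed
  then have f_bound: "\<bar>f x z\<bar> \<le> M" for x z unfolding f_alt M_def by (rule cSUP_upper2) auto
  have M0: "0 \<le> M" using f_bound[of 0 0] by linarith
  \<comment> \<open>\<open>\<phi>bar\<close> is measurable on the range of \<open>P\<close> only;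
    composed with a map into that range it becomes Borel on the whole space.\<close>
  have f_meas: "f x \<in> borel_measurable borel" for x
  proof -
    have "(\<lambda>z. P (z + S t x)) \<in> borel_measurable borel"
      by (intro borel_measurable_continuous_onI P.continuous_on continuous_intros)
    then have "(\<lambda>z. P (z + S t x)) \<in> measurable borel (restrict_space borel (range P))"
      by (intro measurable_restrict_space2) auto
    from measurable_compose[OF this \<phi>bar(1)] show ?thesis unfolding f_alt[abs_def] .
  qed
  define L where "L x k = (\<integral>z. f x z * white_noise Q \<mu> (T k) z \<partial>\<mu>)" for x k
  have L_lin: "bounded_linear (L x)" for x
    unfolding L_def[abs_def] by (rule bounded_linear_integral_white_noise[OF T_lin T_cl f_meas f_bound])
  have L_bound: "\<bar>L x k\<bar> \<le> M * norm (T k)" for x k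
    unfolding L_def by (rule abs_integral_white_noise_le[OF T_cl f_meas f_bound])
  have R\<phi>_shift: "R\<phi> (x + s *\<^sub>R C k) = (\<integral>z. f x (z + s *\<^sub>R R (T k)) \<partial>\<mu>)" if "k \<in> D" for x s k
  proof -
    have "P (z + S t (x + s *\<^sub>R C k)) = P (z + s *\<^sub>R R (T k)) + P (S t x)" for z
      unfolding RT using PSC(2)[OF that] P_id[OF that]
      by (simp add: P.add P.scaleR St.add St.scaleR)
    then show ?thesis by (simp add: R\<phi>_def OU_semigroup_def f_def)
  qed
  have R\<phi>: "R\<phi> x = (\<integral>z. f x z \<partial>\<mu>)" for x
    by (simp add: R\<phi>_def OU_semigroup_def f_alt)
  \<comment> \<open>An explicit rate in \<open>s\<close>: for fixed \<open>k\<close> it gives the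
    directional limit, and with \<open>norm (T k) \<le> onorm T\<close> on the unit ball the uniform
    one.\<close>
  have quotient: "\<bar>(R\<phi> (x + s *\<^sub>R C k) - R\<phi> x) / s - L x k\<bar> \<le> \<bar>s\<bar> * ((norm (T k))\<^sup>2 * M)"
    if k: "k \<in> D" and s: "s \<noteq> 0" for x s k
  proof -
    have "\<bar>R\<phi> (x + s *\<^sub>R C k) - R\<phi> x - s * L x k\<bar> \<le> s\<^sup>2 * (norm (T k))\<^sup>2 * M"
      unfolding R\<phi>_shift[OF k] R\<phi>[of x] L_def
      by (rule shift_taylor_white_noise[OF T_cl is_white_noise_white_noise[OF T_cl] f_meas f_bound])
    then have "\<bar>R\<phi> (x + s *\<^sub>R C k) - R\<phi> x - s * L x k\<bar> / \<bar>s\<bar> \<le> s\<^sup>2 * (norm (T k))\<^sup>2 * M / \<bar>s\<bar>"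
      by (rule divide_right_mono) simp
    moreover have "(R\<phi> (x + s *\<^sub>R C k) - R\<phi> x) / s - L x k = (R\<phi> (x + s *\<^sub>R C k) - R\<phi> x - s * L x k) / s"
      using s by (simp add: diff_divide_distrib)
    moreover have "s\<^sup>2 * (norm (T k))\<^sup>2 * M / \<bar>s\<bar> = \<bar>s\<bar> * ((norm (T k))\<^sup>2 * M)"
    proof -
      have "s\<^sup>2 = \<bar>s\<bar> * \<bar>s\<bar>" by (simp add: power2_eq_square)
      then show ?thesis
        using s nonzero_mult_div_cancel_left[of "\<bar>s\<bar>" "\<bar>s\<bar> * ((norm (T k))\<^sup>2 * M)"]
        by (simp only: mult.assoc)
    qed
    ultimately show ?thesis by (simp only: abs_divide)
  qed
  have gateaux: "has_C_gateaux_derivative D C R\<phi> x (L x)" for x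
    unfolding has_C_gateaux_derivative_def has_C_dir_derivative_def
  proof (intro conjI ballI L_lin)
    fix k assume k: "k \<in> D"
    have "((\<lambda>s. (R\<phi> (x + s *\<^sub>R C k) - R\<phi> x) / s - L x k) \<longlongrightarrow> 0) (at 0)"
    proof (rule Lim_null_comparison)
      show "\<forall>\<^sub>F s in at 0. norm ((R\<phi> (x + s *\<^sub>R C k) - R\<phi> x) / s - L x k) \<le> \<bar>s\<bar> * ((norm (T k))\<^sup>2 * M)"
        using quotient[OF k] by (auto simp: eventually_at_filter)
      show "((\<lambda>s::real. \<bar>s\<bar> * ((norm (T k))\<^sup>2 * M)) \<longlongrightarrow> 0) (at 0)"
        by (auto intro!: tendsto_eq_intros)
    qed
    then show "((\<lambda>s. (R\<phi> (x + s *\<^sub>R C k) - R\<phi> x) / s) \<longlongrightarrow> L x k) (at 0)"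
      by (simp add: LIM_zero_iff)
  qed
  have frechet: "uniform_limit (cball 0 1 \<inter> D) (\<lambda>s k. (R\<phi> (x + s *\<^sub>R C k) - R\<phi> x) / s) (L x) (at 0)" for x
  proof (rule uniform_limitI)
    fix e :: real assume e: "e > 0"
    have "((\<lambda>s::real. \<bar>s\<bar> * ((onorm T)\<^sup>2 * M)) \<longlongrightarrow> 0) (at 0)" by (auto intro!: tendsto_eq_intros)
    then have "\<forall>\<^sub>F s in at 0. \<bar>s\<bar> * ((onorm T)\<^sup>2 * M) < e" using e by (rule order_tendstoD)
    moreover have "\<forall>\<^sub>F s in at (0::real). s \<noteq> 0" by (simp add: eventually_at_filter)
    ultimately show "\<forall>\<^sub>F s in at 0. \<forall>k\<in>cball 0 1 \<inter> D. dist ((R\<phi> (x + s *\<^sub>R C k) - R\<phi> x) / s) (L x k) < e"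
    proof eventually_elim
      case (elim s)
      show ?case
      proof
        fix k assume k: "k \<in> cball 0 1 \<inter> D"
        have "norm (T k) \<le> onorm T * 1"
          using k by (intro order_trans[OF T_norm] mult_left_mono onorm_pos_le T_lin) auto
        then have "(norm (T k))\<^sup>2 \<le> (onorm T)\<^sup>2" by (intro power_mono) auto
        then have "\<bar>s\<bar> * ((norm (T k))\<^sup>2 * M) \<le> \<bar>s\<bar> * ((onorm T)\<^sup>2 * M)"
          using M0 by (intro mult_left_mono mult_right_mono) auto
        moreover have "\<bar>(R\<phi> (x + s *\<^sub>R C k) - R\<phi> x) / s - L x k\<bar> \<le> \<bar>s\<bar> * ((norm (T k))\<^sup>2 * M)"
          using k elim by (intro quotient) auto
        ultimately show "dist ((R\<phi> (x + s *\<^sub>R C k) - R\<phi> x) / s) (L x k) < e"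
          using elim(1) unfolding dist_real_def by linarith
      qed
    qed
  qed
  have grad: "C_gradient D C R\<phi> x \<bullet> k = L x k" for x k
  proof -
    \<comment> \<open>\<open>C_gradient\<close> is a vector of the space \<open>'k\<close>, so the
      functional \<open>L x\<close> must first be represented by one.\<close>
    obtain g where g: "\<And>k. L x k = g \<bullet> k" using riesz_representation[OF L_lin] by blast
    then have "L x = (\<lambda>k. g \<bullet> k)" by blast
    moreover have "closure D = UNIV" using C by (simp add: densely_defined_operator_def)
    ultimately have "C_gradient D C R\<phi> x = g" using gateaux[of x] by (intro C_gradient_eqI) auto
    then show ?thesis by (simp add: g)
  qed
  have "\<bar>C_gradient D C R\<phi> x \<bullet> k\<bar> \<le> M * onorm T * norm k" for x k
  proof -
    have "\<bar>C_gradient D C R\<phi> x \<bullet> k\<bar> \<le> M * norm (T k)" unfolding grad by (rule L_bound)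
    also have "\<dots> \<le> M * (onorm T * norm k)" by (intro mult_left_mono T_norm M0)
    finally show ?thesis by (simp add: mult.assoc)
  qed
  moreover have "C_frechet_differentiable D C R\<phi>"
    unfolding C_frechet_differentiable_def C_frechet_differentiable_at_def using gateaux frechet by blast
  moreover have "C_gradient D C R\<phi> x \<bullet> k = (LINT z|\<mu>. \<phi>bar (P z + P (S t x)) *
      white_noise Q \<mu> (pseudoinverse (op_sqrt Q) (PSC k)) z)" for x k
    unfolding grad L_def f_def T_def ..
  ultimately show ?thesis
    using T_lin unfolding M_def T_def[abs_def] by blast
qed

end
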